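(* Let $f\in L^\infty$ be a real-valued function on the unit circle $\mathbb{T}$ with $f\ge \pi/2$ almost everywhere, and let $E\subset\mathbb{T}$ be a measurable set with $0<|E|<2\pi$. Then there is a positive constant $C$ such that $$ \left|\{t : \widetilde{f\rho_E}(t)>\lambda\}\right| \ge C e^{-\lambda}\qquad\text{for all } \lambda\ge 0 . $$ In particular, $$ \exp\left(\widetilde{f\rho_E}\right)\notin L^1 . $$
   Context: $L^p$ denotes the usual Lebesgue space $L^p(\mathbb{T})$ on the unit circle $\mathbb{T}$; points $e^{i\theta}$ of $\mathbb{T}$ are identified with $\theta\in[0,2\pi)$, and $|A|$ denotes the Lebesgue measure of a measurable $A\subset\mathbb{T}$, so $|\mathbb{T}|=2\pi$. For a measurable set $E\subset\mathbb{T}$, $\rho_E=2\chi_E-1$, i.e. $\rho_E=1$ on $E$ and $\rho_E=-1$ on $\mathbb{T}\setminus E$. For $h\in L^1$, the conjugate function $\tilde h$ (also written $\widetilde{h}$) is defined as follows. Let $u(z)=\frac{1}{2\pi}\int_0^{2\pi}\operatorname{Re}\frac{e^{i\theta}+z}{e^{i\theta}-z}\,h(\theta)\,d\theta$ be the Poisson integral of $h$ on the unit disk $\mathbb{D}$ and let $\tilde u$ be the harmonic conjugate of $u$ normalized by $\tilde u(0)=0$. Then $\tilde h(\theta)$ is the nontangential limit of $\tilde u$ at $e^{i\theta}$, which exists for almost every $\theta$. Equivalently, for almost every $\theta$, $$\tilde h(\theta)=\lim_{\epsilon\to0}\frac1{2\pi}\int_{|\theta-\varphi|>\epsilon}\cot\left(\frac{\theta-\varphi}{2}\right)h(\varphi)\,d\varphi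 .$$ *)

theory Defs
  imports "HOL-Complex_Analysis.Complex_Analysis"
begin

text \<open>
  The unit circle is identified with the interval from \<open>0\<close> (included) to \<open>2 * pi\<close> (excluded)
  via \<open>cis\<close>, and carries Lebesgue measure of total mass \<open>2 * pi\<close>.  Functions on the circle are
  functions of type \<open>real \<Rightarrow> real\<close> whose values outside this interval are irrelevant.
\<close>

definition circle :: "real measure" where
  "circle = lebesgue_on {0..<2 * pi}"

definition L_infinity :: "(real \<Rightarrow> real) set" where
  "L_infinity = {f \<in> borel_measurable circle. \<exists>M. AE t in circle. \<bar>f t\<bar> \<le> M}"

definition rho :: "real set \<Rightarrow> real \<Rightarrow> real" where
  "rho E t = 2 * indicator E t - 1"

definition poisson_integral :: "(real \<Rightarrow> real) \<Rightarrow> complex \<Rightarrow> real" where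
  "poisson_integral h z =
     1 / (2 * pi) * (LINT t|circle. Re ((cis t + z) / (cis t - z)) * h t)"

definition harmonic_conjugate_of :: "(complex \<Rightarrow> real) \<Rightarrow> (complex \<Rightarrow> real) \<Rightarrow> bool" where
  "harmonic_conjugate_of u v \<longleftrightarrow>
     (\<lambda>z. complex_of_real (u z) + \<i> * complex_of_real (v z)) holomorphic_on ball 0 1"

text \<open>
  For \<open>u\<close> harmonic on the unit disk the conditions below determine the conjugate
  uniquely on the disk; its values elsewhere are never used.
\<close>

definition normalized_harmonic_conjugate :: "(complex \<Rightarrow> real) \<Rightarrow> complex \<Rightarrow> real" where
  "normalized_harmonic_conjugate u = (SOME v. harmonic_conjugate_of u v \<and> v 0 = 0)"

definition stolz_region :: "real \<Rightarrow> complex \<Rightarrow> complex set" where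
  "stolz_region a \<zeta> = {z \<in> ball 0 1. norm (\<zeta> - z) < a * (1 - norm z)}"

text \<open>For \<open>a \<le> 1\<close> and \<open>norm \<zeta> = 1\<close> the Stolz region is empty, hence the restriction to apertures \<open>a > 1\<close>.\<close>

definition has_nontangential_limit :: "(complex \<Rightarrow> real) \<Rightarrow> complex \<Rightarrow> real \<Rightarrow> bool" where
  "has_nontangential_limit v \<zeta> l \<longleftrightarrow>
     (\<forall>a>1. (v \<longlongrightarrow> l) (at \<zeta> within stolz_region a \<zeta>))"

text \<open>
  The nontangential limit exists for almost every \<open>t\<close>; on the exceptional null set the
  conjugate function is given the value \<open>0\<close>.
\<close>

definition conjugate_function :: "(real \<Rightarrow> real) \<Rightarrow> real \<Rightarrow> real" where
  "conjugate_function h t =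
     (let v = normalized_harmonic_conjugate (poisson_integral h) in
      if \<exists>l. has_nontangential_limit v (cis t) l
      then THE l. has_nontangential_limit v (cis t) l
      else 0)"

end

theory Submission imports Defs begin

text \<open>
  Write \<open>h = f \<rho>\<^sub>E\<close>, let \<open>u\<close> be its Poisson integral, \<open>v\<close> the normalized conjugate of \<open>u\<close>,
  \<open>F = u + i v\<close>, and \<open>\<bar>h\<bar> \<le> M\<close>.  If \<open>f = \<pi>/2\<close>, then \<open>Re exp (-iF) = exp v * cos u\<close> is a positive harmonic
  function whose boundary values vanish almost everywhere; it is the Poisson integral of a singular
  measure, and this forces \<open>exp v\<close> to have a tail of order \<open>1 / y\<close>.  For larger \<open>f\<close> the cosine
  changes sign where \<open>\<bar>u\<bar> > \<pi>/2\<close>, but \<open>exp v * cos u\<close>, cut off to zero there, is still subharmonic.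

  To isolate the level \<open>s\<close>, the cut-off function is replaced by a bounded one.  There is a continuous
  function \<open>B(u, v) \<ge> 0\<close> on the strip \<open>\<bar>u\<bar> \<le> M\<close> (\<open>barrier\<close>) which is bounded, is subharmonic, vanishes
  where \<open>\<bar>u\<bar> \<ge> \<pi>/2\<close> and \<open>v \<le> 0\<close>, and satisfies \<open>B(0, v) \<ge> c * exp v\<close> for \<open>v\<close> bounded above.
  As \<open>F\<close> is holomorphic, \<open>S = B(u, v - s)\<close> is subharmonic on the disk.  Since \<open>\<bar>h\<bar> \<ge> \<pi>/2\<close> almost everywhere,
  its boundary values vanish almost everywhere off the set where the conjugate function exceeds \<open>s\<close>.
  Hence at every point \<open>S\<close> is at most a constant times the measure of that set.  The function \<open>u\<close> takes both
  signs, because \<open>E\<close> and its complement have positive measure, so it has a zero \<open>z\<^sub>0\<close>, and there \<open>S\<close> is at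
  least \<open>c * exp (v z\<^sub>0 - s)\<close>.  That is the bound of \<open>conjugate_function_distribution_lower_bound\<close>.

  The analytic input is threefold.  Nontangential limits of \<open>F\<close> exist almost everywhere
  (\<open>nontangential_limit_of_bounded_Re\<close>): this is Fatou's theorem for the bounded function \<open>exp F\<close>,
  proved as Fatou did, from the almost everywhere differentiability of a primitive on the circle.
  The radial limits of \<open>u\<close> are \<open>h\<close> (\<open>poisson_integral_radial_limit\<close>).  A continuous subharmonic
  function is dominated by the Poisson integral of its boundary values
  (\<open>subharmonic_le_poisson_integral\<close>); it is applied to dilates of \<open>S\<close>, which are continuous up to
  the circle, and dominated convergence passes to the limit.
\<close>

section \<open>Differentiability of Lipschitz functions\<close>

text \<open>An exceptional null set is harmless for a Lipschitz function: cover it by an open set \<open>U\<close> of small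
  measure and add a multiple, larger than the Lipschitz constant, of the function that measures \<open>U\<close>
  to the left of a point, and a small multiple of the identity.  Arbitrarily close to the right of every point
  the sum is at least as large as at the point, which makes it increasing, and the correction is small.\<close>

lemma le_of_right_dini_nonneg_off_negligible:
  fixes f :: "real \<Rightarrow> real"
  assumes lip: "C-lipschitz_on UNIV f" and N: "negligible N"
    and dini: "\<And>x e d. x \<notin> N \<Longrightarrow> e > 0 \<Longrightarrow> d > 0 \<Longrightarrow> \<exists>h. 0 < h \<and> h < d \<and> - e * h \<le> f (x + h) - f x"
    and "a \<le> b"
  shows "f a \<le> f b"
proof (rule field_le_epsilon)
  fix e0 :: real assume "e0 > 0"
  have C0: "C \<ge> 0" using lip lipschitz_on_nonneg by blast
  define e where "e = e0 / (b - a + C + 2)"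
  have e: "e > 0" using \<open>e0 > 0\<close> C0 \<open>a \<le> b\<close> by (simp add: e_def)
  obtain U where U: "open U" "N \<subseteq> U" "U \<in> lmeasurable" "measure lebesgue U < e"
  proof -
    have "N \<in> lmeasurable" "measure lebesgue N = 0"
      using N negligible_iff_measure by auto
    obtain T where T: "open T" "N \<subseteq> T" "T - N \<in> lmeasurable" "emeasure lebesgue (T - N) < ennreal e"
      using sets_lebesgue_outer_open[OF fmeasurableD[OF \<open>N \<in> lmeasurable\<close>] e] by metis
    have eq: "N \<union> (T - N) = T" using T(2) by blast
    have "T \<in> lmeasurable"
      using fmeasurable.Un[OF \<open>N \<in> lmeasurable\<close> T(3)] unfolding eq .
    moreover have "measure lebesgue T \<le> measure lebesgue N + measure lebesgue (T - N)"
      using measure_Un_le[OF fmeasurableD[OF \<open>N \<in> lmeasurable\<close>] fmeasurableD[OF T(3)]] unfolding eq .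
    moreover have "measure lebesgue (T - N) < e"
      using T(3,4) e by (simp add: emeasure_eq_measure2 ennreal_less_iff)
    ultimately show ?thesis using that[OF T(1,2)] \<open>measure lebesgue N = 0\<close> by linarith
  qed
  have meas: "U \<inter> {x..y} \<in> lmeasurable" for x y
    using U(3) by (simp add: fmeasurable_Int_fmeasurable)
  define m where "m x = measure lebesgue (U \<inter> {a..x})" for x
  have m_add: "m y = m x + measure lebesgue (U \<inter> {x..y})" if "a \<le> x" "x \<le> y" for x y
  proof -
    have "U \<inter> {a..y} = (U \<inter> {a..x}) \<union> (U \<inter> {x..y})" using that by auto
    moreover have "measure lebesgue (U \<inter> {a..x} \<inter> (U \<inter> {x..y})) = 0"
      by (rule negligible_imp_measure0, rule negligible_subset[of "{x}"]) auto
    ultimately show ?thesis unfolding m_def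
      using measure_Un3[OF meas[of a x] meas[of x y]] by simp
  qed
  have m_lip: "\<bar>m y - m x\<bar> \<le> \<bar>y - x\<bar>" if "a \<le> x" "a \<le> y" for x y
  proof -
    have *: "\<bar>m y - m x\<bar> \<le> \<bar>y - x\<bar>" if "a \<le> x" "x \<le> y" for x y
    proof -
      have "measure lebesgue (U \<inter> {x..y}) \<le> measure lebesgue {x..y}"
        by (intro measure_mono_fmeasurable) (auto simp: U(3) meas fmeasurableD)
      then show ?thesis using m_add[OF that] that by simp
    qed
    show ?thesis using *[of x y] *[of y x] that by (cases "x \<le> y") auto
  qed
  define k where "k x = f x + (C + 1) * m x + e * x" for x
  have flip: "\<bar>f y - f x\<bar> \<le> C * \<bar>y - x\<bar>" for x y
    using lipschitz_onD[OF lip, of y x] by (simp add: dist_real_def)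
  have klip: "\<bar>k y - k x\<bar> \<le> (2 * C + 1 + e) * \<bar>y - x\<bar>" if "a \<le> x" "a \<le> y" for x y
  proof -
    have "\<bar>(C + 1) * (m y - m x)\<bar> \<le> (C + 1) * \<bar>y - x\<bar>"
      using m_lip[OF that] C0 by (simp add: abs_mult mult_left_mono)
    moreover have "\<bar>e * (y - x)\<bar> = e * \<bar>y - x\<bar>" using e by (simp add: abs_mult)
    moreover have "k y - k x = (f y - f x) + (C + 1) * (m y - m x) + e * (y - x)"
      by (simp add: k_def algebra_simps)
    moreover have "(2 * C + 1 + e) * \<bar>y - x\<bar> = C * \<bar>y - x\<bar> + (C + 1) * \<bar>y - x\<bar> + e * \<bar>y - x\<bar>"
      by (simp add: algebra_simps)
    ultimately show ?thesis using flip[of y x] by linarith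
  qed
  have kcont: "continuous_on {a..b} k"
  proof -
    have "(2 * C + 1 + e)-lipschitz_on {a..b} k"
      using klip C0 e by (intro lipschitz_onI) (auto simp: dist_real_def)
    then show ?thesis by (rule lipschitz_on_continuous_on)
  qed
  \<comment> \<open>On the null set the slope \<open>C + 1\<close> of the measure term beats the Lipschitz constant; off it the term \<open>e * x\<close> beats the loss in the Dini condition.\<close>
  have step: "\<exists>h. 0 < h \<and> h < d \<and> k x \<le> k (x + h)" if "a \<le> x" "d > 0" for x d
  proof (cases "x \<in> N")
    case True
    then obtain r where r: "r > 0" "ball x r \<subseteq> U" using U by (meson open_contains_ball subsetD)
    define h where "h = min d r / 2"
    have h: "0 < h" "h < d" "h < r" using r that by (auto simp: h_def min_def)
    have "{x..x+h} \<subseteq> U" using r h by (intro order_trans[OF _ r(2)]) (auto simp: dist_real_def)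
    then have "m (x + h) = m x + h"
      using m_add[of x "x + h"] that h by (simp add: inf_absorb2)
    then have "k (x + h) - k x = f (x + h) - f x + (C + 1) * h + e * h"
      by (simp add: k_def algebra_simps)
    moreover have "f (x + h) - f x \<ge> - C * h" using flip[of "x+h" x] h by auto
    moreover have "(C + 1) * h = C * h + h" "e * h \<ge> 0" using e h by (auto simp: algebra_simps)
    ultimately have "k x \<le> k (x + h)" using h by linarith
    with h show ?thesis by auto
  next
    case False
    from dini[OF this e \<open>d > 0\<close>] obtain h where h: "0 < h" "h < d" "- e * h \<le> f (x + h) - f x" by auto
    have "m x \<le> m (x + h)" using m_add[of x "x+h"] h that by simp
    then have "(C + 1) * m x \<le> (C + 1) * m (x + h)" using C0 by (intro mult_left_mono) auto
    then have "k x \<le> k (x + h)" using h by (simp add: k_def algebra_simps)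
    with h show ?thesis by auto
  qed
  have "k a \<le> k b"
  proof (rule ccontr)
    assume "\<not> k a \<le> k b"
    define T where "T = {x \<in> {a..b}. k a \<le> k x}"
    have "closed T" unfolding T_def
      by (rule continuous_on_closed_Collect_le[OF continuous_on_const kcont]) simp
    moreover have "T \<noteq> {}" "bdd_above T" using \<open>a \<le> b\<close> by (auto simp: T_def)
    ultimately have ST: "Sup T \<in> T" by (rule closed_contains_Sup[rotated 2])
    then have "Sup T \<noteq> b" "Sup T \<le> b" "a \<le> Sup T" "k a \<le> k (Sup T)" using \<open>\<not> k a \<le> k b\<close> by (auto simp: T_def)
    then obtain h where h: "0 < h" "h < b - Sup T" "k (Sup T) \<le> k (Sup T + h)" using step[of "Sup T" "b - Sup T"] by auto
    then have "Sup T + h \<in> T" using \<open>k a \<le> k (Sup T)\<close> \<open>a \<le> Sup T\<close> by (auto simp: T_def)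
    then have "Sup T + h \<le> Sup T" using \<open>bdd_above T\<close> by (rule cSup_upper)
    then show False using h by simp
  qed
  moreover have "m a \<ge> 0" by (simp add: m_def)
  moreover have "m b \<le> e"
    using measure_mono_fmeasurable[of "U \<inter> {a..b}" U lebesgue] U meas by (auto simp: m_def fmeasurableD)
  ultimately have "f a \<le> f b + (C + 1) * e + e * (b - a)"
  proof -
    assume 1: "k a \<le> k b" "m a \<ge> 0" "m b \<le> e"
    have "(C + 1) * m a \<ge> 0" "(C + 1) * m b \<le> (C + 1) * e" using 1 C0 by (auto intro: mult_left_mono)
    then show ?thesis using 1 by (simp add: k_def algebra_simps)
  qed
  also have "\<dots> = f b + e * (b - a + C + 1)" by (simp add: algebra_simps)
  also have "\<dots> \<le> f b + e0"
  proof -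
    have "e0 = e * (b - a + C + 2)" using C0 \<open>a \<le> b\<close> by (simp add: e_def)
    then show ?thesis using e by (simp add: algebra_simps)
  qed
  finally show "f a \<le> f b + e0" .
qed

text \<open>The difference of two integrals is the signed integral from \<open>0\<close>, written so that it makes sense on both
  sides of \<open>0\<close>.\<close>

lemma indefinite_integral_diff:
  fixes \<phi> :: "real \<Rightarrow> real"
  assumes int: "\<And>a b. \<phi> integrable_on {a..b}" and that: "a \<le> b"
  shows "(integral {0..b} \<phi> - integral {b..0} \<phi>) - (integral {0..a} \<phi> - integral {a..0} \<phi>) = integral {a..b} \<phi>"
proof -
    have c: "integral {x..z} \<phi> = integral {x..y} \<phi> + integral {y..z} \<phi>" if "x \<le> y" "y \<le> z" for x y z
      using Henstock_Kurzweil_Integration.integral_combine[OF that int] by simp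
    have z: "integral {y..x} \<phi> = 0" if "x \<le> y" for x y
      using that by (cases "x = y") auto
    consider "0 \<le> a" | "b \<le> 0" | "a < 0" "0 < b" by linarith
    then show ?thesis
    proof cases
      case 1 then show ?thesis using c[of 0 a b] that by (auto simp: z)
    next
      case 2 then show ?thesis using c[of a b 0] that by (auto simp: z)
    next
      case 3 then show ?thesis using c[of a 0 b] by (auto simp: z)
    qed
  qed

text \<open>Lebesgue's differentiation theorem on the line.  The one-sided version for boxes with a fixed lower
  corner gives the right derivative; applied to the reflected function it gives the left one.\<close>

lemma indefinite_integral_has_derivative_AE:
  fixes \<phi> :: "real \<Rightarrow> real"
  assumes int: "\<And>a b. \<phi> integrable_on {a..b}"
  defines "\<Phi> \<equiv> \<lambda>y. integral {0..y} \<phi> - integral {y..0} \<phi>"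
  obtains N where "negligible N" "\<And>x. x \<notin> N \<Longrightarrow> (\<Phi> has_real_derivative \<phi> x) (at x)"
proof -
  have Phi: "\<Phi> b - \<Phi> a = integral {a..b} \<phi>" if "a \<le> b" for a b
    unfolding \<Phi>_def using that by (rule indefinite_integral_diff[OF int])
  obtain N1 where N1: "negligible N1"
    "\<And>x e. \<lbrakk>x \<notin> N1; 0 < e\<rbrakk> \<Longrightarrow> \<exists>d>0. \<forall>h. 0 < h \<and> h < d \<longrightarrow> norm (integral {x..x+h} \<phi> / h - \<phi> x) < e"
    using integrable_ccontinuous_explicit[of \<phi>] int by (auto simp: divide_inverse mult.commute)
  have int': "(\<lambda>x. \<phi> (- x)) integrable_on cbox a b" for a b
    using Henstock_Kurzweil_Integration.integrable_reflect_real[where f=\<phi> and a="-b" and b="-a"] int[of "-b" "-a"] by simp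
  obtain N2 where N2: "negligible N2"
    "\<And>x e. \<lbrakk>x \<notin> N2; 0 < e\<rbrakk> \<Longrightarrow> \<exists>d>0. \<forall>h. 0 < h \<and> h < d \<longrightarrow> norm (integral {x..x+h} (\<lambda>x. \<phi> (- x)) / h - \<phi> (- x)) < e"
    using integrable_ccontinuous_explicit[of "\<lambda>x. \<phi> (- x)", OF int'] by (auto simp: divide_inverse mult.commute)
  have "negligible (uminus ` N2)"
    using N2(1) by (intro negligible_differentiable_image_negligible derivative_intros) auto
  moreover have "(\<Phi> has_real_derivative \<phi> x) (at x)" if x: "x \<notin> N1 \<union> uminus ` N2" for x
    unfolding has_field_derivative_iff LIM_eq
  proof (intro allI impI)
    fix e :: real assume "e > 0"
    have "x \<notin> N1" "- x \<notin> N2" using x by (auto simp: image_iff)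
    then obtain d1 d2 where d: "d1 > 0" "d2 > 0"
      "\<And>h. 0 < h \<Longrightarrow> h < d1 \<Longrightarrow> norm (integral {x..x+h} \<phi> / h - \<phi> x) < e"
      "\<And>h. 0 < h \<Longrightarrow> h < d2 \<Longrightarrow> norm (integral {-x..-x+h} (\<lambda>x. \<phi> (- x)) / h - \<phi> x) < e"
      using N1(2)[of x e] N2(2)[of "-x" e] \<open>e > 0\<close> by (metis minus_minus)
    have "norm ((\<Phi> y - \<Phi> x) / (y - x) - \<phi> x) < e" if y: "y \<noteq> x" "norm (y - x) < min d1 d2" for y
    proof (cases "x < y")
      case True
      then show ?thesis using d(3)[of "y - x"] y Phi[of x y] by auto
    next
      case False
      have "integral {-x..-x+(x-y)} (\<lambda>x. \<phi> (- x)) = integral {y..x} \<phi>"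
        using integral_reflect_real[of x y \<phi>] by simp
      moreover have "(\<Phi> y - \<Phi> x) / (y - x) = integral {y..x} \<phi> / (x - y)"
        using Phi[of y x] False y by (simp add: divide_simps) (auto simp: algebra_simps)
      ultimately show ?thesis using d(4)[of "x - y"] y False by auto
    qed
    then show "\<exists>s>0. \<forall>y. y \<noteq> x \<and> norm (y - x) < s \<longrightarrow> norm ((\<Phi> y - \<Phi> x) / (y - x) - \<phi> x) < e"
      using d(1,2) by (intro exI[of _ "min d1 d2"]) auto
  qed
  ultimately show ?thesis using N1(1) by (intro that[of "N1 \<union> uminus ` N2"]) auto
qed


text \<open>The steps \<open>1 / (n + 1)\<close> form a countable family, so the upper limit of the quotients is measurable, and
  they come arbitrarily close to \<open>0\<close>, which is all that the Dini condition asks for.\<close>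

definition difference_quotient :: "(real \<Rightarrow> real) \<Rightarrow> nat \<Rightarrow> real \<Rightarrow> real" where
  "difference_quotient f n x = (f (x + 1 / real (Suc n)) - f x) * real (Suc n)"

definition upper_derivate :: "(real \<Rightarrow> real) \<Rightarrow> real \<Rightarrow> real" where
  "upper_derivate f x = real_of_ereal (limsup (\<lambda>n. ereal (difference_quotient f n x)))"

text \<open>Subtract from \<open>f\<close> the indefinite integral of its upper derivate.  At almost every point the
  integral has the upper derivate as derivative, so the difference has right upper derivate at least \<open>0\<close>
  there, and it is therefore increasing.\<close>

lemma lipschitz_ge_integral_upper_derivate:
  fixes f :: "real \<Rightarrow> real"
  assumes lip: "C-lipschitz_on UNIV f"
  shows "limsup (\<lambda>n. ereal (difference_quotient f n x)) = ereal (upper_derivate f x)"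
    and "upper_derivate f integrable_on {a..b}"
    and "a \<le> b \<Longrightarrow> integral {a..b} (upper_derivate f) \<le> f b - f a"
proof -
  define \<phi> where "\<phi> = upper_derivate f"
  define q where "q = difference_quotient f"
  have q_def': "q n x = (f (x + 1 / real (Suc n)) - f x) * real (Suc n)" for n x
    by (simp only: q_def difference_quotient_def)
  have \<phi>_eq: "\<phi> x = real_of_ereal (limsup (\<lambda>n. ereal (q n x)))" for x
    by (simp only: \<phi>_def q_def upper_derivate_def)
  have C0: "C \<ge> 0" using lip lipschitz_on_nonneg by blast
  have flip: "\<bar>f y - f x\<bar> \<le> C * \<bar>y - x\<bar>" for x y
    using lipschitz_onD[OF lip, of y x] by (simp add: dist_real_def)
  have fcont: "continuous_on UNIV f" by (rule lipschitz_on_continuous_on[OF lip])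
  have qb: "\<bar>q n x\<bar> \<le> C" for n x
  proof -
    have "\<bar>q n x\<bar> \<le> (C * (1 / real (Suc n))) * real (Suc n)"
      unfolding q_def' abs_mult using flip[of "x + 1 / real (Suc n)" x] by (intro mult_mono) auto
    then show ?thesis by simp
  qed
  have lb: "ereal (- C) \<le> limsup (\<lambda>n. ereal (q n x))" for x
  proof -
    have "ereal (-C) \<le> liminf (\<lambda>n. ereal (q n x))"
      using qb[of _ x] by (intro Liminf_bounded always_eventually) (auto simp: abs_le_iff minus_le_iff)
    also have "\<dots> \<le> limsup (\<lambda>n. ereal (q n x))" by (intro Liminf_le_Limsup) simp
    finally show ?thesis .
  qed
  have ub: "limsup (\<lambda>n. ereal (q n x)) \<le> ereal C" for x
    using qb[of _ x] by (intro Limsup_bounded always_eventually) (auto simp: abs_le_iff)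
  have lim: "limsup (\<lambda>n. ereal (q n x)) = ereal (\<phi> x)" for x
    using lb[of x] ub[of x] unfolding \<phi>_eq by (cases "limsup (\<lambda>n. ereal (q n x))") auto
  have phib: "\<bar>\<phi> x\<bar> \<le> C" for x using lb[of x] ub[of x] unfolding lim by auto
  have "\<phi> \<in> borel_measurable borel"
  proof -
    have [measurable]: "f \<in> borel_measurable borel" using fcont by (rule borel_measurable_continuous_onI)
    show ?thesis unfolding \<phi>_eq q_def' by measurable
  qed
  then have phim: "\<phi> \<in> borel_measurable lebesgue" by (simp add: measurable_completion)
  have int: "\<phi> integrable_on {a..b}" for a b
  proof (rule measurable_bounded_by_integrable_imp_integrable)
    show "\<phi> \<in> borel_measurable (lebesgue_on {a..b})" using phim by (rule measurable_restrict_space1)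
    show "(\<lambda>_. C) integrable_on {a..b}" by (rule integrable_const_ivl)
    show "\<And>x. x \<in> {a..b} \<Longrightarrow> norm (\<phi> x) \<le> C" using phib by simp
  qed auto
  define \<Phi> where "\<Phi> y = integral {0..y} \<phi> - integral {y..0} \<phi>" for y
  obtain N where N: "negligible N" "\<And>x. x \<notin> N \<Longrightarrow> (\<Phi> has_real_derivative \<phi> x) (at x)"
    using indefinite_integral_has_derivative_AE[OF int] unfolding \<Phi>_def by metis
  have Phi: "\<Phi> b - \<Phi> a = integral {a..b} \<phi>" if "a \<le> b" for a b
    unfolding \<Phi>_def using that by (rule indefinite_integral_diff[OF int])
  have Philip: "\<bar>\<Phi> y - \<Phi> x\<bar> \<le> C * \<bar>y - x\<bar>" for x y
  proof -
    have *: "\<bar>\<Phi> y - \<Phi> x\<bar> \<le> C * \<bar>y - x\<bar>" if "x \<le> y" for x y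
    proof -
      have "norm (integral {x..y} \<phi>) \<le> C * measure lborel {x..y}"
        by (rule has_integral_bound_real[OF C0 finite.emptyI integrable_integral[OF int]]) (use phib in simp)
      then show ?thesis using Phi[OF that] that by simp
    qed
    show ?thesis using *[of x y] *[of y x] by (cases "x \<le> y") (auto simp: abs_minus_commute)
  qed
  show "limsup (\<lambda>n. ereal (difference_quotient f n x)) = ereal (upper_derivate f x)"
    "upper_derivate f integrable_on {a..b}"
    using lim int unfolding q_def \<phi>_def by blast+
  show "integral {a..b} (upper_derivate f) \<le> f b - f a" if "a \<le> b"
  proof -
    have "f a - \<Phi> a \<le> f b - \<Phi> b"
    proof (rule le_of_right_dini_nonneg_off_negligible[OF _ N(1) _ that])
      show "(2 * C)-lipschitz_on UNIV (\<lambda>x. f x - \<Phi> x)"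
      proof (intro lipschitz_onI)
        fix x y
        show "dist (f x - \<Phi> x) (f y - \<Phi> y) \<le> 2 * C * dist x y"
          using flip[of x y] Philip[of x y] unfolding dist_real_def by linarith
      qed (use C0 in simp)
    next
      fix x e d :: real assume x: "x \<notin> N" "e > 0" "d > 0"
      obtain s where s: "s > 0" "\<And>y. y \<noteq> x \<Longrightarrow> \<bar>y - x\<bar> < s \<Longrightarrow> \<bar>(\<Phi> y - \<Phi> x) / (y - x) - \<phi> x\<bar> < e / 2"
        using N(2)[OF x(1)] x(2) unfolding has_field_derivative_iff LIM_eq by (metis half_gt_zero real_norm_def)
      obtain n0 :: nat where n0: "inverse (real (Suc n0)) < min s d" using reals_Archimedean[of "min s d"] s x by auto
      have "\<exists>n\<ge>n0. \<phi> x - e / 2 < q n x"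
      proof (rule ccontr)
        assume "\<not> ?thesis"
        then have "\<forall>\<^sub>F n in sequentially. ereal (q n x) \<le> ereal (\<phi> x - e / 2)"
          by (auto simp: eventually_sequentially not_less intro!: exI[of _ n0])
        then have "limsup (\<lambda>n. ereal (q n x)) \<le> ereal (\<phi> x - e / 2)" by (rule Limsup_bounded)
        then show False using lim[of x] x(2) by simp
      qed
      then obtain n where n: "n \<ge> n0" "\<phi> x - e / 2 < q n x" by auto
      define h where "h = 1 / real (Suc n)"
      have "h \<le> inverse (real (Suc n0))"
        using n(1) by (simp add: h_def inverse_eq_divide frac_le)
      then have h: "h > 0" "h < s" "h < d" using n0 by (auto simp: h_def)
      have "(f (x + h) - f x) = q n x * h" by (simp add: q_def' h_def)
      moreover have "\<bar>(\<Phi> (x + h) - \<Phi> x) / (x + h - x) - \<phi> x\<bar> < e / 2" using h by (intro s(2)) auto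
      then have "(\<Phi> (x + h) - \<Phi> x) / h < \<phi> x + e / 2" unfolding add_diff_cancel_left' by linarith
      then have "\<Phi> (x + h) - \<Phi> x < (\<phi> x + e / 2) * h" using h by (simp add: divide_simps)
      moreover have "(\<phi> x - e / 2) * h \<le> q n x * h" using n h by (intro mult_right_mono) auto
      ultimately have "- e * h \<le> (f (x + h) - \<Phi> (x + h)) - (f x - \<Phi> x)" by (simp add: algebra_simps)
      then show "\<exists>h>0. h < d \<and> - e * h \<le> (f (x + h) - \<Phi> (x + h)) - (f x - \<Phi> x)" using h by auto
    qed
    then show ?thesis using Phi[OF that] by (simp add: \<phi>_def)
  qed
qed

text \<open>The previous estimate for \<open>f\<close> and for \<open>-f\<close>, together with the fact that a lower limit is at most the upper one,
  makes \<open>f\<close> the indefinite integral of its upper derivate; then Lebesgue's theorem applies.\<close>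

lemma lipschitz_real_differentiable_AE:
  fixes f :: "real \<Rightarrow> real"
  assumes lip: "C-lipschitz_on UNIV f"
  obtains N where "negligible N" "\<And>x. x \<notin> N \<Longrightarrow> \<exists>D. (f has_real_derivative D) (at x)"
proof -
  have lip': "C-lipschitz_on UNIV (\<lambda>x. - f x)"
    using lip by (rule lipschitz_on_minus)
  note up = lipschitz_ge_integral_upper_derivate[OF lip]
  note lo = lipschitz_ge_integral_upper_derivate[OF lip']
  have "- upper_derivate f x \<le> upper_derivate (\<lambda>x. - f x) x" for x
  proof -
    have dq: "difference_quotient (\<lambda>x. - f x) n x = - difference_quotient f n x" for n
      by (simp only: difference_quotient_def minus_diff_minus minus_mult_left)
    have "ereal (upper_derivate (\<lambda>x. - f x) x) = limsup (\<lambda>n. - ereal (difference_quotient f n x))"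
      using lo(1)[of x, symmetric] by (simp only: dq uminus_ereal.simps)
    also have "\<dots> = - liminf (\<lambda>n. ereal (difference_quotient f n x))" by (rule ereal_Limsup_uminus)
    also have "\<dots> \<ge> - limsup (\<lambda>n. ereal (difference_quotient f n x))" by (simp add: Liminf_le_Limsup)
    finally show ?thesis unfolding up(1) by simp
  qed
  then have lo4: "integral {a..b} (\<lambda>x. - upper_derivate f x) \<le> integral {a..b} (upper_derivate (\<lambda>x. - f x))" for a b
    using up(2) lo(2) by (intro integral_le integrable_neg) auto
  have eq: "f b - f a = integral {a..b} (upper_derivate f)" if "a \<le> b" for a b
  proof -
    have "integral {a..b} (\<lambda>x. - upper_derivate f x) = - integral {a..b} (upper_derivate f)" by simp
    then show ?thesis using up(3)[OF that] lo(3)[OF that] lo4[of a b] by linarith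
  qed
  define \<Phi> where "\<Phi> y = integral {0..y} (upper_derivate f) - integral {y..0} (upper_derivate f)" for y
  obtain N where N: "negligible N" "\<And>x. x \<notin> N \<Longrightarrow> (\<Phi> has_real_derivative upper_derivate f x) (at x)"
    using indefinite_integral_has_derivative_AE[OF up(2)] unfolding \<Phi>_def by metis
  have "f y = f 0 + \<Phi> y" for y
  proof (cases "0 \<le> y")
    case True then show ?thesis using eq[OF True] by (cases "y = 0") (auto simp: \<Phi>_def)
  next
    case False then show ?thesis using eq[of y 0] by (auto simp: \<Phi>_def)
  qed
  then have f_eq: "f = (\<lambda>y. f 0 + \<Phi> y)" by (rule ext)
  have "(f has_real_derivative upper_derivate f x) (at x)" if "x \<notin> N" for x
  proof -
    have "((\<lambda>y. f 0 + \<Phi> y) has_real_derivative 0 + upper_derivate f x) (at x)"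
      by (intro DERIV_add DERIV_const N(2) that)
    then show ?thesis unfolding f_eq[symmetric] by simp
  qed
  then show ?thesis using that N(1) by blast
qed

section \<open>The Poisson and Herglotz kernels\<close>

definition poisson_kernel :: "complex \<Rightarrow> real \<Rightarrow> real" where
  "poisson_kernel z t = Re ((cis t + z) / (cis t - z))"

lemma poisson_integral_kernel:
  "poisson_integral h z = 1 / (2 * pi) * (LINT t|circle. poisson_kernel z t * h t)"
  by (simp add: poisson_integral_def poisson_kernel_def)

lemma space_circle [simp]: "space circle = {0..<2*pi}"
  by (simp add: circle_def)

lemma measure_space_circle: "measure circle (space circle) = 2 * pi"
  by (simp add: circle_def measure_restrict_space)

lemma finite_measure_circle: "finite_measure circle"
  unfolding circle_def by (intro finite_measure_lebesgue_on bounded_set_imp_lmeasurable) auto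

interpretation circle: finite_measure circle by (rule finite_measure_circle)

lemma measurable_circle_continuous:
  fixes g :: "real \<Rightarrow> 'b::{euclidean_space}"
  assumes "continuous_on UNIV g"
  shows "g \<in> borel_measurable circle"
  unfolding circle_def
  by (rule measurable_restrict_space1) (use assms in \<open>simp add: borel_measurable_continuous_onI measurable_completion\<close>)

lemma cis_ne_of_norm_less: "norm z < 1 \<Longrightarrow> cis t \<noteq> z"
  using norm_cis[of t] by auto

lemma norm_cis_minus_ge: "1 - norm z \<le> norm (cis t - z)"
  using norm_triangle_ineq2[of "cis t" z] by simp

lemma poisson_kernel_eq:
  assumes "norm z < 1"
  shows "poisson_kernel z t = (1 - (norm z)\<^sup>2) / (norm (cis t - z))\<^sup>2"
proof -
  have "Re ((cis t + z) * cnj (cis t - z)) = (norm (cis t))\<^sup>2 - (norm z)\<^sup>2"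
    unfolding cmod_power2 by (simp add: algebra_simps power2_eq_square)
  then show ?thesis
    unfolding poisson_kernel_def complex_div_cnj[of "cis t + z"]
    by (simp add: Re_divide_of_real[symmetric] flip: of_real_power)
qed

lemma poisson_kernel_nonneg: "norm z < 1 \<Longrightarrow> 0 \<le> poisson_kernel z t"
  by (simp add: poisson_kernel_eq power_le_one)

lemma poisson_kernel_le:
  assumes "norm z < 1"
  shows "poisson_kernel z t \<le> (1 + norm z) / (1 - norm z)"
proof -
  have "(1 - norm z)\<^sup>2 \<le> (norm (cis t - z))\<^sup>2"
    using norm_cis_minus_ge[of z t] assms by (intro power_mono) auto
  then have "poisson_kernel z t \<le> (1 - (norm z)\<^sup>2) / (1 - norm z)\<^sup>2"
    unfolding poisson_kernel_eq[OF assms] using assms cis_ne_of_norm_less[OF assms] by (intro divide_left_mono) (auto simp: power_le_one)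
  also have "\<dots> = (1 + norm z) / (1 - norm z)"
    using assms by (simp add: power2_eq_square divide_simps) (simp add: algebra_simps)
  finally show ?thesis .
qed

lemma measurable_poisson_kernel: "norm z < 1 \<Longrightarrow> poisson_kernel z \<in> borel_measurable circle"
  unfolding poisson_kernel_def
  by (intro measurable_circle_continuous continuous_intros) (auto simp: cis_ne_of_norm_less)

lemma integrable_circle_bounded:
  fixes g :: "real \<Rightarrow> 'b::{banach,second_countable_topology}"
  assumes "g \<in> borel_measurable circle" "AE t in circle. norm (g t) \<le> B"
  shows "integrable circle g"
  by (rule circle.integrable_const_bound[OF assms(2,1)])

text \<open>The bridge from contour integrals, which Cauchy's theorem evaluates, to Lebesgue integrals over the
  circle.\<close>

lemma contour_integral_circle_LINT:
  assumes cont: "continuous_on (sphere 0 1) g"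
    and ci: "(g has_contour_integral I) (circlepath 0 1)"
  shows "(LINT t|circle. g (cis t) * (\<i> * cis t)) = I"
proof -
  have "(g has_contour_integral I) (part_circlepath 0 1 0 (2 * pi))"
    using ci by (simp add: circlepath_def)
  then have hi: "((\<lambda>t. g (0 + of_real 1 * cis t) * of_real 1 * \<i> * cis t) has_integral I) {0..2 * pi}"
    by (subst (asm) has_contour_integral_part_circlepath_iff) simp_all
  have c: "continuous_on UNIV (\<lambda>t. g (cis t) * (\<i> * cis t))"
    by (intro continuous_intros continuous_on_compose2[OF cont]) auto
  have "bounded (g ` sphere 0 1)"
    by (intro compact_imp_bounded compact_continuous_image cont) simp
  then obtain B where B: "\<And>t. norm (g (cis t)) \<le> B" unfolding bounded_iff by force
  have "integrable circle (\<lambda>t. g (cis t) * (\<i> * cis t))"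
    using B by (intro integrable_circle_bounded[where B = B] measurable_circle_continuous c) (simp add: norm_mult)
  then have "(LINT t|circle. g (cis t) * (\<i> * cis t)) = integral {0..<2*pi} (\<lambda>t. g (cis t) * (\<i> * cis t))"
    unfolding circle_def by (intro lebesgue_integral_eq_integral) auto
  also have "\<dots> = integral {0..2*pi} (\<lambda>t. g (cis t) * (\<i> * cis t))"
    by (rule integral_spike_set) (auto intro: negligible_subset[of "{2*pi}"])
  also have "\<dots> = I" using hi by (simp add: integral_unique mult.assoc)
  finally show ?thesis .
qed

text \<open>In terms of \<open>w = cis t\<close> and \<open>dw = i w dt\<close>, the integrand is \<open>-i (2 / (w - z) - 1 / w)\<close>, and
  both poles lie inside the circle.\<close>

lemma integral_herglotz_kernel:
  assumes "norm z < 1"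
  shows "(LINT t|circle. (cis t + z) / (cis t - z)) = 2 * pi"
proof -
  let ?g = "\<lambda>w. - \<i> * (2 / (w - z) - 1 / (w - 0))"
  have 1: "((\<lambda>w. 1 / (w - y)) has_contour_integral 2 * of_real pi * \<i>) (circlepath 0 1)" if "norm y < 1" for y
    using Cauchy_integral_circlepath_simple[of "\<lambda>_. 1" 0 1 y] that by simp
  have "(?g has_contour_integral - \<i> * (2 * (2 * of_real pi * \<i>) - 2 * of_real pi * \<i>)) (circlepath 0 1)"
    using has_contour_integral_lmul[OF has_contour_integral_diff[OF has_contour_integral_lmul[OF 1[OF assms], of 2] 1[of 0]], of "-\<i>"]
    by simp
  then have "(LINT t|circle. ?g (cis t) * (\<i> * cis t)) = - \<i> * (2 * (2 * of_real pi * \<i>) - 2 * of_real pi * \<i>)"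
    using assms by (intro contour_integral_circle_LINT continuous_intros) auto
  moreover have "?g (cis t) * (\<i> * cis t) = (cis t + z) / (cis t - z)" for t
    using cis_ne_of_norm_less[OF assms, of t] by (simp add: divide_simps) (simp add: algebra_simps)
  ultimately show ?thesis by (simp add: algebra_simps)
qed

lemma Re_herglotz_kernel_mult:
  "Re ((cis t + z) / (cis t - z) * of_real x) = poisson_kernel z t * x"
proof -
  have "Re (w * of_real x) = Re w * x" for w by simp
  then show ?thesis by (simp only: poisson_kernel_def)
qed

lemma integrable_herglotz_kernel_mult:
  fixes h :: "real \<Rightarrow> real"
  assumes "norm z < 1" and h: "h \<in> borel_measurable circle" "AE t in circle. \<bar>h t\<bar> \<le> B"
  shows "integrable circle (\<lambda>t. (cis t + z) / (cis t - z) * h t)"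
    and "integrable circle (\<lambda>t. poisson_kernel z t * h t)"
proof -
  let ?k = "\<lambda>t. (cis t + z) / (cis t - z)"
  have [measurable]: "?k \<in> borel_measurable circle" "h \<in> borel_measurable circle"
    using h by (auto intro!: measurable_circle_continuous continuous_intros simp: cis_ne_of_norm_less assms(1))
  have nk: "norm (?k t) \<le> 2 / (1 - norm z)" for t
    unfolding norm_divide using norm_triangle_ineq[of "cis t" z] norm_cis_minus_ge[of z t] assms(1)
    by (intro frac_le) auto
  show 1: "integrable circle (\<lambda>t. ?k t * h t)"
  proof (rule integrable_circle_bounded)
    show "AE t in circle. norm (?k t * h t) \<le> 2 / (1 - norm z) * B"
      using h(2)
    proof eventually_elim
      case (elim t)
      show ?case unfolding norm_mult using nk[of t] elim assms(1) by (intro mult_mono) auto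
    qed
  qed measurable
  have "integrable circle (\<lambda>t. Re (?k t * h t))" using 1 by (rule integrable_Re)
  then show "integrable circle (\<lambda>t. poisson_kernel z t * h t)" by (simp only: Re_herglotz_kernel_mult)
qed

lemma poisson_integral_const: "norm z < 1 \<Longrightarrow> poisson_integral (\<lambda>_. c) z = c"
proof -
  assume z: "norm z < 1"
  have "(LINT t|circle. poisson_kernel z t) = Re (LINT t|circle. (cis t + z) / (cis t - z))"
    unfolding poisson_kernel_def using integrable_herglotz_kernel_mult(1)[OF z, of "\<lambda>_. 1" 1]
    by (intro integral_Re) simp
  then show ?thesis unfolding poisson_integral_kernel integral_herglotz_kernel[OF z] by simp
qed

lemma integral_poisson_kernel: "norm z < 1 \<Longrightarrow> (LINT t|circle. poisson_kernel z t) = 2 * pi"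
  using poisson_integral_const[of z 1] by (simp add: poisson_integral_kernel)

lemma poisson_integral_abs_le:
  assumes z: "norm z < 1" and h: "h \<in> borel_measurable circle" "AE t in circle. \<bar>h t\<bar> \<le> B"
  shows "\<bar>poisson_integral h z\<bar> \<le> B"
proof -
  have "\<bar>LINT t|circle. poisson_kernel z t * h t\<bar> \<le> (LINT t|circle. \<bar>poisson_kernel z t * h t\<bar>)"
    by (rule integral_abs_bound)
  also have "\<dots> \<le> (LINT t|circle. poisson_kernel z t * B)"
  proof (rule integral_mono_AE)
    show "integrable circle (\<lambda>t. \<bar>poisson_kernel z t * h t\<bar>)" "integrable circle (\<lambda>t. poisson_kernel z t * B)"
      using integrable_herglotz_kernel_mult(2)[OF z h] integrable_herglotz_kernel_mult(2)[OF z, of "\<lambda>_. B" "\<bar>B\<bar>"] by auto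
    show "AE t in circle. \<bar>poisson_kernel z t * h t\<bar> \<le> poisson_kernel z t * B"
      using h(2) by eventually_elim (use poisson_kernel_nonneg[OF z] in \<open>auto simp: abs_mult intro!: mult_left_mono\<close>)
  qed
  also have "\<dots> = 2 * pi * B" by (simp add: integral_poisson_kernel z)
  finally show ?thesis unfolding poisson_integral_kernel by (simp add: abs_mult divide_simps mult.commute)
qed

text \<open>The holomorphic function whose real part is the Poisson integral; it shows that a harmonic conjugate exists.\<close>

definition herglotz_integral :: "(real \<Rightarrow> real) \<Rightarrow> complex \<Rightarrow> complex" where
  "herglotz_integral h z = 1 / (2 * pi) * (LINT t|circle. (cis t + z) / (cis t - z) * h t)"

lemma Re_herglotz_integral:
  assumes z: "norm z < 1" and h: "h \<in> borel_measurable circle" "AE t in circle. \<bar>h t\<bar> \<le> B"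
  shows "Re (herglotz_integral h z) = poisson_integral h z"
proof -
  have "(LINT t|circle. poisson_kernel z t * h t) = Re (LINT t|circle. (cis t + z) / (cis t - z) * h t)"
    unfolding integral_Re[OF integrable_herglotz_kernel_mult(1)[OF z h], symmetric]
    by (simp only: Re_herglotz_kernel_mult)
  then show ?thesis
    by (simp add: herglotz_integral_def poisson_integral_kernel)
qed

text \<open>Differentiation under the integral sign: on a smaller disk the difference quotients of the kernel
  are bounded uniformly, so dominated convergence applies along every sequence tending to \<open>z\<close>.\<close>

lemma holomorphic_herglotz_integral:
  assumes h: "h \<in> borel_measurable circle" "AE t in circle. \<bar>h t\<bar> \<le> B"
  shows "herglotz_integral h holomorphic_on ball 0 1"
proof -
  let ?k = "\<lambda>z t. (cis t + z) / (cis t - z)"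
  define I where "I z = (LINT t|circle. ?k z t * h t)" for z
  have "(I has_field_derivative (LINT t|circle. 2 * cis t / (cis t - z)\<^sup>2 * h t)) (at z)" if z: "z \<in> ball 0 1" for z
    unfolding has_field_derivative_iff tendsto_at_iff_sequentially comp_def
  proof (intro allI impI)
    fix X :: "nat \<Rightarrow> complex" assume X: "\<forall>i. X i \<in> UNIV - {z}" "X \<longlonglongrightarrow> z"
    define d where "d = (1 - norm z) / 2"
    have d: "d > 0" "norm z = 1 - 2 * d" using z by (auto simp: d_def field_simps)
    have "\<forall>\<^sub>F i in sequentially. dist (X i) z < d" using X(2) d by (simp add: tendsto_iff)
    then obtain n0 where n0: "\<And>i. i \<ge> n0 \<Longrightarrow> dist (X i) z < d" by (auto simp: eventually_sequentially)
    define Y where "Y i = X (i + n0)" for i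
    have Y: "Y i \<noteq> z" "norm (Y i) < 1 - d" for i
      using X(1) n0[of "i + n0"] d norm_triangle_ineq2[of "Y i" z] by (auto simp: Y_def dist_norm)
    have Ylim: "Y \<longlonglongrightarrow> z" unfolding Y_def using X(2) by (rule LIMSEQ_ignore_initial_segment)
    have nd: "norm (cis t - z) \<ge> d" "norm (cis t - Y i) \<ge> d" for t i
      using norm_cis_minus_ge[of z t] norm_cis_minus_ge[of "Y i" t] Y(2)[of i] d by auto
    have ne: "cis t \<noteq> z" "cis t \<noteq> Y i" for t i
      using cis_ne_of_norm_less[of z t] cis_ne_of_norm_less[of "Y i" t] Y(2)[of i] d by auto
    have quot: "(?k (Y i) t - ?k z t) / (Y i - z) = 2 * cis t / ((cis t - z) * (cis t - Y i))" for i t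
      using ne(1)[of t] ne(2)[of t i] Y(1)[of i] by (simp add: divide_simps) (simp add: algebra_simps)
    have "(\<lambda>i. LINT t|circle. 2 * cis t / ((cis t - z) * (cis t - Y i)) * h t)
          \<longlonglongrightarrow> (LINT t|circle. 2 * cis t / (cis t - z)\<^sup>2 * h t)"
    proof (rule integral_dominated_convergence[where w = "\<lambda>t. 2 / (d * d) * B"])
      have [measurable]: "h \<in> borel_measurable circle" by fact
      have [measurable]: "(\<lambda>t. 2 * cis t / (cis t - z)\<^sup>2) \<in> borel_measurable circle"
        "(\<lambda>t. 2 * cis t / ((cis t - z) * (cis t - Y i))) \<in> borel_measurable circle" for i
        using ne by (auto intro!: measurable_circle_continuous continuous_intros)
      show "(\<lambda>t. 2 * cis t / (cis t - z)\<^sup>2 * h t) \<in> borel_measurable circle"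
        "(\<lambda>t. 2 * cis t / ((cis t - z) * (cis t - Y i)) * h t) \<in> borel_measurable circle" for i by measurable
      show "integrable circle (\<lambda>t. 2 / (d * d) * B)" by simp
      show "AE t in circle. (\<lambda>i. 2 * cis t / ((cis t - z) * (cis t - Y i)) * h t) \<longlonglongrightarrow> 2 * cis t / (cis t - z)\<^sup>2 * h t"
        unfolding power2_eq_square using ne by (intro AE_I2 tendsto_intros Ylim) auto
      show "AE t in circle. norm (2 * cis t / ((cis t - z) * (cis t - Y i)) * h t) \<le> 2 / (d * d) * B" for i
        using h(2)
      proof eventually_elim
        case (elim t)
        have "norm (2 * cis t / ((cis t - z) * (cis t - Y i))) \<le> 2 / (d * d)"
          unfolding norm_divide norm_mult using nd[of t] d by (intro frac_le mult_mono) auto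
        then show ?case unfolding norm_mult[of _ "of_real (h t)"] using elim d by (intro mult_mono) auto
      qed
    qed
    moreover have "(LINT t|circle. 2 * cis t / ((cis t - z) * (cis t - Y i)) * h t) = (I (Y i) - I z) / (Y i - z)" for i
    proof -
      have "norm (Y i) < 1" "norm z < 1" using Y(2)[of i] d by auto
      note int = integrable_herglotz_kernel_mult(1)[OF this(1) h] integrable_herglotz_kernel_mult(1)[OF this(2) h]
      have "I (Y i) - I z = (LINT t|circle. ?k (Y i) t * h t - ?k z t * h t)"
        unfolding I_def using int by (intro Bochner_Integration.integral_diff[symmetric])
      then have "(I (Y i) - I z) / (Y i - z) = (LINT t|circle. (?k (Y i) t * h t - ?k z t * h t) / (Y i - z))"
        by simp
      also have "(\<lambda>t. (?k (Y i) t * h t - ?k z t * h t) / (Y i - z)) = (\<lambda>t. 2 * cis t / ((cis t - z) * (cis t - Y i)) * h t)"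
        unfolding quot[symmetric] by (simp add: fun_eq_iff diff_divide_distrib left_diff_distrib)
      finally show ?thesis by simp
    qed
    ultimately have "(\<lambda>i. (I (Y i) - I z) / (Y i - z)) \<longlonglongrightarrow> (LINT t|circle. 2 * cis t / (cis t - z)\<^sup>2 * h t)" by simp
    then show "(\<lambda>i. (I (X i) - I z) / (X i - z)) \<longlonglongrightarrow> (LINT t|circle. 2 * cis t / (cis t - z)\<^sup>2 * h t)"
      unfolding Y_def by (rule LIMSEQ_offset)
  qed
  then have "I holomorphic_on ball 0 1" by (meson holomorphic_on_open open_ball)
  then show ?thesis unfolding herglotz_integral_def I_def[symmetric] by (intro holomorphic_intros)
qed

text \<open>The Poisson kernel is an approximate identity.  The hypothesis on \<open>k\<close> is continuity at the
  single point \<open>\<zeta>\<close>, measured by the distance on the circle, so that the endpoint \<open>0\<close> of the parameter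
  interval needs no separate treatment.  The approach to \<open>\<zeta>\<close> is unrestricted.\<close>

lemma poisson_integral_tendsto:
  assumes k: "k \<in> borel_measurable circle" "\<And>t. t \<in> space circle \<Longrightarrow> \<bar>k t\<bar> \<le> B"
    and "norm \<zeta> = 1"
    and lim: "\<And>e. e > 0 \<Longrightarrow> \<exists>d>0. \<forall>t\<in>space circle. norm (cis t - \<zeta>) < d \<longrightarrow> \<bar>k t - c\<bar> \<le> e"
  shows "(poisson_integral k \<longlongrightarrow> c) (at \<zeta> within ball 0 1)"
proof (rule tendstoI)
  fix e :: real assume "e > 0"
  then obtain d where d: "d > 0" "\<And>t. t \<in> space circle \<Longrightarrow> norm (cis t - \<zeta>) < d \<Longrightarrow> \<bar>k t - c\<bar> \<le> e / 2"
    using lim[of "e/2"] by (auto simp del: space_circle)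
  define B' where "B' = \<bar>B\<bar> + \<bar>c\<bar>"
  have kb: "\<bar>k t - c\<bar> \<le> B'" if "t \<in> space circle" for t
    using k(2)[OF that] by (auto simp: B'_def)
  have bound: "\<bar>poisson_integral k z - c\<bar> \<le> e / 2 + (1 - (norm z)\<^sup>2) / (d/2)\<^sup>2 * B'"
    if z: "norm z < 1" "norm (z - \<zeta>) < d / 2" for z
  proof -
    let ?D = "(1 - (norm z)\<^sup>2) / (d/2)\<^sup>2 * B'"
    have AEk: "AE t in circle. \<bar>k t\<bar> \<le> B" using k(2) by (intro AE_I2)
    have m: "(\<lambda>t. k t - c) \<in> borel_measurable circle" using k(1) by simp
    have AEkc: "AE t in circle. \<bar>k t - c\<bar> \<le> B'" using kb by (intro AE_I2)
    have i1: "integrable circle (\<lambda>t. poisson_kernel z t)"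
      using integrable_herglotz_kernel_mult(2)[OF z(1), of "\<lambda>_. 1" 1] by simp
    have "(LINT t|circle. poisson_kernel z t * (k t - c)) = (LINT t|circle. poisson_kernel z t * k t) - (LINT t|circle. poisson_kernel z t * c)"
      unfolding right_diff_distrib using i1 by (intro Bochner_Integration.integral_diff integrable_herglotz_kernel_mult(2)[OF z(1) k(1) AEk]) auto
    then have "2 * pi * (poisson_integral k z - c) = (LINT t|circle. poisson_kernel z t * (k t - c))"
      by (simp add: poisson_integral_kernel integral_poisson_kernel z right_diff_distrib)
    moreover have "\<bar>LINT t|circle. poisson_kernel z t * (k t - c)\<bar> \<le> (LINT t|circle. poisson_kernel z t * (e/2) + ?D)"
    proof (rule integral_abs_bound_integral)
      show "integrable circle (\<lambda>t. poisson_kernel z t * (k t - c))"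
        by (rule integrable_herglotz_kernel_mult(2)[OF z(1) m AEkc])
      show "integrable circle (\<lambda>t. poisson_kernel z t * (e/2) + ?D)" using i1 by auto
      show "\<bar>poisson_kernel z t * (k t - c)\<bar> \<le> poisson_kernel z t * (e/2) + ?D" if t: "t \<in> space circle" for t
      proof -
        have P0: "poisson_kernel z t \<ge> 0" using poisson_kernel_nonneg z by auto
        have B0: "B' \<ge> 0" by (simp add: B'_def)
        have n1: "(norm z)\<^sup>2 \<le> 1" using z by (simp add: power_le_one)
        show "\<bar>poisson_kernel z t * (k t - c)\<bar> \<le> poisson_kernel z t * (e/2) + ?D"
        proof (cases "norm (cis t - \<zeta>) < d")
          case True
          have "\<bar>poisson_kernel z t * (k t - c)\<bar> \<le> poisson_kernel z t * (e/2)"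
            unfolding abs_mult abs_of_nonneg[OF P0] using d(2)[OF t True] P0 by (intro mult_left_mono)
          moreover have "?D \<ge> 0" using B0 n1 by simp
          ultimately show ?thesis by linarith
        next
          case False
          have "norm (cis t - \<zeta>) \<le> norm (cis t - z) + norm (z - \<zeta>)"
            using norm_triangle_ineq[of "cis t - z" "z - \<zeta>"] by simp
          then have "norm (cis t - z) \<ge> d / 2" using False z by auto
          then have "(d/2)\<^sup>2 \<le> (norm (cis t - z))\<^sup>2" using d by (intro power_mono) auto
          then have "poisson_kernel z t \<le> (1 - (norm z)\<^sup>2) / (d/2)\<^sup>2"
            unfolding poisson_kernel_eq[OF z(1)] using d n1 cis_ne_of_norm_less[OF z(1)] by (intro divide_left_mono) auto
          then have "\<bar>poisson_kernel z t * (k t - c)\<bar> \<le> ?D"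
            unfolding abs_mult using kb[OF t] P0 B0 by (intro mult_mono) auto
          then show ?thesis using P0 \<open>e > 0\<close> by (simp add: add_increasing)
        qed
      qed
    qed
    moreover have "(LINT t|circle. poisson_kernel z t * (e/2) + ?D) = 2 * pi * (e / 2 + ?D)"
      using i1 measure_space_circle by (simp add: integral_poisson_kernel z algebra_simps)
    ultimately have "2 * pi * \<bar>poisson_integral k z - c\<bar> \<le> 2 * pi * (e / 2 + ?D)"
      by (metis abs_mult abs_of_nonneg mult_nonneg_nonneg pi_ge_zero zero_le_numeral)
    then show ?thesis by simp
  qed
  have "((\<lambda>z. (1 - (norm z)\<^sup>2) / (d/2)\<^sup>2 * B') \<longlongrightarrow> (1 - (norm \<zeta>)\<^sup>2) / (d/2)\<^sup>2 * B') (at \<zeta> within ball 0 1)"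
    by (intro tendsto_intros) (use d in auto)
  then have "\<forall>\<^sub>F z in at \<zeta> within ball 0 1. (1 - (norm z)\<^sup>2) / (d/2)\<^sup>2 * B' < e / 2"
    using \<open>e > 0\<close> \<open>norm \<zeta> = 1\<close> by (intro order_tendstoD(2)) auto
  moreover have "\<forall>\<^sub>F z in at \<zeta> within ball 0 1. dist z \<zeta> < d / 2"
    using d(1) by (intro tendstoD[OF tendsto_ident_at]) auto
  moreover have "\<forall>\<^sub>F z in at \<zeta> within ball 0 1. norm z < 1"
    by (simp add: eventually_at_filter)
  ultimately show "\<forall>\<^sub>F z in at \<zeta> within ball 0 1. dist (poisson_integral k z) c < e"
  proof eventually_elim
    case (elim z)
    have "norm (z - \<zeta>) < d / 2" using elim(2) by (simp only: dist_norm)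
    from bound[OF elim(3) this] elim(1) show ?case unfolding dist_real_def by linarith
  qed
qed

section \<open>Domination of subharmonic functions by Poisson integrals\<close>

text \<open>Subharmonicity in the form in which it is easy to check for a maximum of finitely many
  harmonic pieces: the function is touched from below at \<open>z\<close> by a harmonic function, given as the real
  part of a holomorphic one.  The sub-mean-value inequality on small circles follows from it.\<close>

definition subharmonic_support :: "(complex \<Rightarrow> real) \<Rightarrow> complex \<Rightarrow> bool" where
  "subharmonic_support S z \<longleftrightarrow> (\<exists>V q. open V \<and> z \<in> V \<and> q holomorphic_on V \<and> Re (q z) = S z \<and> (\<forall>w\<in>V. Re (q w) \<le> S w))"

text \<open>If \<open>S - T\<close> had a positive maximum, take a maximum point \<open>x\<close> of largest modulus; it lies inside the disk.  Near \<open>x\<close> the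
  harmonic function that supports \<open>S\<close>, minus \<open>T\<close>, has a local maximum at \<open>x\<close>, hence is constant by
  the maximum modulus principle applied to its exponential.  So nearby points, some of them of larger modulus, are
  maximum points as well.\<close>

lemma maximum_principle_subharmonic:
  assumes contS: "continuous_on (cball 0 1) S" and contT: "continuous_on (cball 0 1) T"
    and supp: "\<And>z. z \<in> ball 0 1 \<Longrightarrow> subharmonic_support S z"
    and Q: "Q holomorphic_on ball 0 1" "\<And>z. z \<in> ball 0 1 \<Longrightarrow> Re (Q z) = T z"
    and boundary: "\<And>z. norm z = 1 \<Longrightarrow> S z \<le> T z"
    and z: "z \<in> ball (0::complex) 1"
  shows "S z \<le> T z"
proof (rule ccontr)
  assume "\<not> S z \<le> T z"
  define D where "D w = S w - T w" for w
  have contD: "continuous_on (cball 0 1) D" unfolding D_def by (intro continuous_intros contS contT)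
  obtain x0 where x0: "x0 \<in> cball 0 1" "\<And>y. y \<in> cball 0 1 \<Longrightarrow> D y \<le> D x0"
    using continuous_attains_sup[OF compact_cball _ contD] by force
  define A where "A = cball 0 1 \<inter> D -` {D x0}"
  have "closed A" unfolding A_def by (intro continuous_closed_preimage contD) auto
  then have "compact A" unfolding A_def by (simp add: compact_eq_bounded_closed)
       (meson Int_lower1 bounded_cball bounded_subset)
  then obtain x where x: "x \<in> A" "\<And>y. y \<in> A \<Longrightarrow> norm y \<le> norm x"
    using continuous_attains_sup[of A norm] x0(1) by (force simp: A_def intro: continuous_intros)
  have Dx: "D x = D x0" "norm x \<le> 1" using x(1) by (auto simp: A_def)
  have "D x0 > 0" using x0(2)[of z] z \<open>\<not> S z \<le> T z\<close> by (force simp: D_def)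
  then have "norm x \<noteq> 1" using boundary[of x] Dx by (auto simp: D_def)
  then have xb: "x \<in> ball 0 1" using Dx by simp
  from supp[OF this] obtain V q where V: "open V" "x \<in> V" "q holomorphic_on V" "Re (q x) = S x"
    "\<And>w. w \<in> V \<Longrightarrow> Re (q w) \<le> S w" unfolding subharmonic_support_def by blast
  have "open (V \<inter> ball 0 1)" using V(1) by blast
  then obtain d where d: "d > 0" "ball x d \<subseteq> V \<inter> ball 0 1"
    using V(2) xb by (meson Int_iff open_contains_ball)
  define f where "f w = exp (q w - Q w)" for w
  have "f holomorphic_on ball x d"
    unfolding f_def using d(2) by (intro holomorphic_intros holomorphic_on_subset[OF V(3)] holomorphic_on_subset[OF Q(1)]) auto
  moreover have le: "norm (f w) \<le> exp (D w)" if "w \<in> ball x d" for w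
  proof -
    have "w \<in> V" "w \<in> ball 0 1" using that d(2) by auto
    then show ?thesis using V(5)[of w] Q(2)[of w] by (simp add: f_def D_def)
  qed
  have nfx: "norm (f x) = exp (D x)" using V(4) Q(2)[OF xb] by (simp add: f_def D_def)
  have "norm (f w) \<le> norm (f x)" if "w \<in> ball x d" for w
  proof -
    have "w \<in> cball 0 1" using that d(2) by auto
    then have "exp (D w) \<le> exp (D x)" using x0(2)[of w] Dx(1) by simp
    then show ?thesis using le[OF that] nfx by linarith
  qed
  ultimately have "f constant_on ball x d"
    using d(1) by (intro maximum_modulus_principle[where U = "ball x d" and \<xi> = x]) auto
  then have const: "f w = f x" if "w \<in> ball x d" for w using that d(1) unfolding constant_on_def by (metis centre_in_ball)
  \<comment> \<open>A unit vector in the direction of \<open>x\<close>, arbitrary if \<open>x = 0\<close>.\<close>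
  define e where "e = (if x = 0 then 1 else x / of_real (norm x))"
  have e: "norm e = 1" "x = of_real (norm x) * e" by (auto simp: e_def norm_divide)
  \<comment> \<open>Moving outward along the ray through \<open>x\<close> contradicts the choice of \<open>x\<close>.\<close>
  define w where "w = of_real (norm x + d / 2) * e"
  have "w = x + of_real (d / 2) * e" by (subst e(2)) (simp add: w_def algebra_simps)
  then have wb: "w \<in> ball x d" using d(1) e(1) by (simp add: dist_norm norm_mult)
  have "norm w = norm x + d / 2" unfolding w_def norm_mult norm_of_real e(1) using d(1) by simp
  moreover have "w \<in> A"
  proof -
    have "exp (D x) \<le> exp (D w)" using le[OF wb] const[OF wb] nfx by simp
    then have "D w = D x0" using x0(2)[of w] wb d(2) Dx by force
    then show ?thesis using wb d(2) by (force simp: A_def)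
  qed
  ultimately show False using x(2)[of w] d(1) by simp
qed

text \<open>The Poisson integral of the continuous boundary values, continued by these values to the circle,
  solves the Dirichlet problem and can be compared with \<open>S\<close> by the maximum principle.\<close>

lemma subharmonic_le_poisson_integral:
  assumes contS: "continuous_on (cball 0 1) S"
    and supp: "\<And>z. z \<in> ball 0 1 \<Longrightarrow> subharmonic_support S z"
    and z: "z \<in> ball 0 1"
  shows "S z \<le> poisson_integral (\<lambda>t. S (cis t)) z"
proof -
  define k where "k t = S (cis t)" for t
  have "continuous_on UNIV k" unfolding k_def
    by (intro continuous_on_compose2[OF contS] continuous_intros) auto
  then have km: "k \<in> borel_measurable circle" by (rule measurable_circle_continuous)
  have "bounded (S ` cball 0 1)" by (intro compact_imp_bounded compact_continuous_image contS compact_cball)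
  then obtain B where "\<And>y. y \<in> cball 0 1 \<Longrightarrow> norm (S y) \<le> B" unfolding bounded_iff by blast
  then have kB: "\<bar>k t\<bar> \<le> B" for t by (simp add: k_def)
  then have AEk: "AE t in circle. \<bar>k t\<bar> \<le> B" by simp
  define T where "T w = (if w \<in> ball 0 1 then poisson_integral k w else S w)" for w
  have lim: "(poisson_integral k \<longlongrightarrow> S \<zeta>) (at \<zeta> within ball 0 1)" if \<zeta>: "norm \<zeta> = 1" for \<zeta>
  proof (rule poisson_integral_tendsto[OF km kB \<zeta>])
    fix e :: real assume "e > 0"
    then obtain d where d: "d > 0" "\<And>w. w \<in> cball 0 1 \<Longrightarrow> dist w \<zeta> < d \<Longrightarrow> dist (S w) (S \<zeta>) < e"
      using contS \<zeta> unfolding continuous_on_iff by (metis mem_cball_0 order_refl)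
    then have "\<bar>k t - S \<zeta>\<bar> \<le> e" if "norm (cis t - \<zeta>) < d" for t
      using that d(2)[of "cis t"] by (simp add: dist_norm k_def less_imp_le)
    then show "\<exists>d>0. \<forall>t\<in>space circle. norm (cis t - \<zeta>) < d \<longrightarrow> \<bar>k t - S \<zeta>\<bar> \<le> e" using d(1) by blast
  qed
  have hol: "herglotz_integral k holomorphic_on ball 0 1" by (rule holomorphic_herglotz_integral[OF km AEk])
  have Re: "Re (herglotz_integral k w) = poisson_integral k w" if "w \<in> ball 0 1" for w
    using that by (intro Re_herglotz_integral[OF _ km AEk]) simp
  have contP: "continuous_on (ball 0 1) (poisson_integral k)"
    using continuous_on_Re[OF holomorphic_on_imp_continuous_on[OF hol]] by (rule continuous_on_eq) (rule Re)
  have "continuous (at x within cball 0 1) T" if x: "x \<in> cball 0 1" for x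
  proof (cases "x \<in> ball 0 1")
    case True
    then have "isCont (poisson_integral k) x" using contP by (simp add: continuous_on_eq_continuous_at)
    moreover have "\<forall>\<^sub>F w in nhds x. poisson_integral k w = T w"
      using eventually_nhds_in_open[OF open_ball True] by eventually_elim (simp add: T_def)
    ultimately have "isCont T x" using isCont_cong by blast
    then show ?thesis by (rule continuous_at_imp_continuous_at_within)
  next
    case False
    then have nx: "norm x = 1" using x by simp
    have "(T \<longlongrightarrow> S x) (at x within ball 0 1)"
      by (rule Lim_transform_eventually[OF lim[OF nx]]) (auto simp: eventually_at_filter T_def)
    moreover have "(T \<longlongrightarrow> S x) (at x within sphere 0 1)"
    proof (rule Lim_transform_eventually)
      show "(S \<longlongrightarrow> S x) (at x within sphere 0 1)"
        by (rule tendsto_within_subset[where S = "cball 0 1"]) (use contS x in \<open>auto simp: continuous_on_def\<close>)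
      show "\<forall>\<^sub>F w in at x within sphere 0 1. S w = T w" by (auto simp: eventually_at_filter T_def)
    qed
    ultimately have "(T \<longlongrightarrow> S x) (at x within ball 0 1 \<union> sphere 0 1)" by (simp add: Lim_within_Un)
    moreover have "ball 0 1 \<union> sphere 0 1 = cball (0::complex) 1" by auto
    ultimately show ?thesis using False by (simp add: continuous_within T_def)
  qed
  then have contT: "continuous_on (cball 0 1) T" by (simp add: continuous_on_eq_continuous_within)
  have "S z \<le> T z"
  proof (rule maximum_principle_subharmonic[OF contS contT supp hol _ _ z])
    show "Re (herglotz_integral k w) = T w" if "w \<in> ball 0 1" for w using Re[OF that] that by (simp add: T_def)
    show "S w \<le> T w" if "norm w = 1" for w using that by (simp add: T_def)
  qed
  moreover have "k = (\<lambda>t. S (cis t))" by (simp add: k_def fun_eq_iff)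
  ultimately show ?thesis using z by (simp add: T_def)
qed

section \<open>Fatou's theorem on nontangential limits\<close>

lemma stolz_region_subset_ball: "stolz_region a \<zeta> \<subseteq> ball 0 1"
  by (auto simp: stolz_region_def)

text \<open>Convexity is used for connectedness: a continuous logarithm has no room to jump inside a Stolz region.\<close>

lemma convex_stolz_region:
  assumes "a \<ge> 0"
  shows "convex (stolz_region a \<zeta>)"
proof -
  have "convex {z. norm (\<zeta> - z) < a * (1 - norm z)}"
  proof (rule convexI)
    fix x y :: complex and u v :: real
    assume *: "x \<in> {z. norm (\<zeta> - z) < a * (1 - norm z)}" "y \<in> {z. norm (\<zeta> - z) < a * (1 - norm z)}"
      and uv: "0 \<le> u" "0 \<le> v" "u + v = 1"
    have "\<zeta> - (u *\<^sub>R x + v *\<^sub>R y) = u *\<^sub>R (\<zeta> - x) + v *\<^sub>R (\<zeta> - y)"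
      using uv(3) by (simp add: algebra_simps flip: scaleR_add_left)
    then have "norm (\<zeta> - (u *\<^sub>R x + v *\<^sub>R y)) \<le> u * norm (\<zeta> - x) + v * norm (\<zeta> - y)"
      using norm_triangle_ineq[of "u *\<^sub>R (\<zeta> - x)" "v *\<^sub>R (\<zeta> - y)"] uv by simp
    also have "\<dots> < u * (a * (1 - norm x)) + v * (a * (1 - norm y))"
    proof (cases "u = 0")
      case True then show ?thesis using * uv by auto
    next
      case False
      then have "u * norm (\<zeta> - x) < u * (a * (1 - norm x))" using * uv by (intro mult_strict_left_mono) auto
      moreover have "v * norm (\<zeta> - y) \<le> v * (a * (1 - norm y))" using * uv by (intro mult_left_mono) auto
      ultimately show ?thesis by (rule add_less_le_mono)
    qed
    also have "\<dots> = a * ((u + v) - (u * norm x + v * norm y))" by (simp add: algebra_simps)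
    also have "\<dots> = a * (1 - (u * norm x + v * norm y))" by (simp only: uv(3))
    also have "\<dots> \<le> a * (1 - norm (u *\<^sub>R x + v *\<^sub>R y))"
      using norm_triangle_ineq[of "u *\<^sub>R x" "v *\<^sub>R y"] uv assms by (intro mult_left_mono) auto
    finally show "u *\<^sub>R x + v *\<^sub>R y \<in> {z. norm (\<zeta> - z) < a * (1 - norm z)}" by simp
  qed
  moreover have "stolz_region a \<zeta> = ball 0 1 \<inter> {z. norm (\<zeta> - z) < a * (1 - norm z)}"
    by (auto simp: stolz_region_def)
  ultimately show ?thesis by (simp add: convex_Int)
qed

text \<open>Let \<open>R\<close> be \<open>G\<close> minus the affine function with slope \<open>b\<close> that agrees with \<open>G\<close> at \<open>\<zeta>\<close>.  Cauchy's formula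
  expresses \<open>g z - b\<close> by the integral of \<open>R\<close> against \<open>1 / (w - z)^2\<close>, whose modulus is too large by a
  logarithm.  The same kernel at the reflected point \<open>1 / cnj z\<close> integrates \<open>R\<close> to zero, and the difference of
  the two kernels is of the size of the Poisson kernel divided by \<open>\<bar>w - z\<bar>\<close>.  In a Stolz region
  \<open>\<bar>w - \<zeta>\<bar> \<le> (1 + a) \<bar>w - z\<bar>\<close>, so the linear smallness of \<open>R\<close> at \<open>\<zeta>\<close> absorbs that denominator.\<close>

lemma derivative_minus_slope_le_poisson_integral:
  fixes G g :: "complex \<Rightarrow> complex"
  assumes contG: "continuous_on (cball 0 1) G"
    and G': "\<And>z. z \<in> ball 0 1 \<Longrightarrow> (G has_field_derivative g z) (at z)"
    and \<zeta>: "norm \<zeta> = 1"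
    and k: "k \<in> borel_measurable circle" "\<And>t. 0 \<le> k t" "\<And>t. k t \<le> B"
    and R: "\<And>t. norm (G (cis t) - G \<zeta> - b * (cis t - \<zeta>)) \<le> k t * norm (cis t - \<zeta>)"
    and z: "z \<in> stolz_region a \<zeta>"
  shows "norm (g z - b) \<le> 2 * (1 + a) * poisson_integral k z"
proof -
  define R where "R w = G w - G \<zeta> - b * (w - \<zeta>)" for w
  have z1: "norm z < 1" and za: "norm (\<zeta> - z) < a * (1 - norm z)" using z by (auto simp: stolz_region_def)
  have contR: "continuous_on (cball 0 1) R" unfolding R_def by (intro continuous_intros contG)
  have derR: "(R has_field_derivative g z - b) (at z)" if "z \<in> ball 0 1" for z
    unfolding R_def using G'[OF that] by (auto intro!: derivative_eq_intros)
  have holR: "R holomorphic_on ball 0 1" using derR holomorphic_on_open open_ball by blast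
  have nz: "1 - cnj z * w \<noteq> 0" if "norm w \<le> 1" for w
  proof -
    have "norm (cnj z * w) < 1" using that z1 by (simp add: norm_mult) (metis mult_left_le norm_ge_zero order_le_less_trans)
    then show ?thesis by (metis eq_iff_diff_eq_0 less_irrefl norm_one)
  qed
  \<comment> \<open>Writing the kernel at \<open>1 / cnj z\<close> in this form covers \<open>z = 0\<close> as well.\<close>
  let ?D = "\<lambda>w. 1 / (w - z)^2 - (cnj z / (1 - cnj z * w))^2"
  have "((\<lambda>w. R w / (w - z)^2) has_contour_integral 2 * pi * \<i> * (g z - b)) (circlepath 0 1)"
  proof -
    have z': "z \<in> ball 0 1" using z1 by simp
    note C = Cauchy_derivative_integral_circlepath[OF contR holR z']
    have "g z - b = 1 / (2 * of_real pi * \<i>) * contour_integral (circlepath 0 1) (\<lambda>u. R u / (u - z)\<^sup>2)"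
      by (rule DERIV_unique[OF derR[OF z'] C(2)])
    then show ?thesis using has_contour_integral_integral[OF C(1)] by simp
  qed
  moreover have "((\<lambda>w. R w * (cnj z / (1 - cnj z * w))^2) has_contour_integral 0) (circlepath 0 1)"
  proof (rule Cauchy_theorem_disc[where K = "{}" and a = 0 and e = 1])
    show "continuous_on (cball 0 1) (\<lambda>w. R w * (cnj z / (1 - cnj z * w))\<^sup>2)"
      by (intro continuous_intros contR) (use nz in auto)
    show "(\<lambda>w. R w * (cnj z / (1 - cnj z * w))\<^sup>2) field_differentiable at x" if "x \<in> ball 0 1 - {}" for x
      using that nz[of x] derR[of x]
      by (intro derivative_intros) (auto simp: field_differentiable_def)
  qed auto
  ultimately have "((\<lambda>w. R w / (w - z)^2 - R w * (cnj z / (1 - cnj z * w))^2) has_contour_integral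
      2 * pi * \<i> * (g z - b) - 0) (circlepath 0 1)"
    by (rule has_contour_integral_diff)
  then have ci: "((\<lambda>w. R w * ?D w) has_contour_integral 2 * pi * \<i> * (g z - b)) (circlepath 0 1)"
    by (simp add: right_diff_distrib)
  have "continuous_on (sphere 0 1) (\<lambda>w. R w * ?D w)"
    by (intro continuous_intros continuous_on_subset[OF contR]) (use nz z1 in auto)
  from contour_integral_circle_LINT[OF this ci]
  have I: "(LINT t|circle. R (cis t) * ?D (cis t) * (\<i> * cis t)) = 2 * pi * \<i> * (g z - b)" .
  have pt: "norm (R (cis t) * ?D (cis t) * (\<i> * cis t)) \<le> 2 * (1 + a) * (poisson_kernel z t * k t)" for t
  proof -
    define w where "w = cis t"
    define n where "n = norm (w - z)"
    have w: "norm w = 1" "w * cnj w = 1" "w \<noteq> 0" by (auto simp: w_def cis_mult cis_cnj)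
    have n: "n > 0" using cis_ne_of_norm_less[OF z1, of t] by (simp add: n_def w_def)
    \<comment> \<open>On the circle the two denominators have the same modulus.\<close>
    have "1 - cnj z * w = w * cnj (w - z)" using w(2) by (simp add: algebra_simps)
    then have n1: "norm (1 - cnj z * w) = n" by (simp only: norm_mult complex_mod_cnj w(1) n_def mult_1)
    have wz: "norm (w - \<zeta>) \<le> (1 + a) * n"
    proof -
      have "norm (w - \<zeta>) \<le> n + norm (\<zeta> - z)"
        using norm_triangle_ineq[of "w - z" "z - \<zeta>"] by (simp add: n_def norm_minus_commute)
      also have "norm (\<zeta> - z) \<le> a * n"
      proof -
        have "0 < a * (1 - norm z)" using za norm_ge_zero[of "\<zeta> - z"] by linarith
        then have "a > 0" using z1 by (simp add: zero_less_mult_iff)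
        then have "a * (1 - norm z) \<le> a * n" using norm_cis_minus_ge[of z t] unfolding n_def w_def by (intro mult_left_mono) auto
        then show ?thesis using za by linarith
      qed
      finally show ?thesis by (simp add: algebra_simps)
    qed
    have zz: "cnj z * z = of_real ((norm z)\<^sup>2)" by (metis complex_norm_square mult.commute)
    have "1 - cnj z * z = of_real (1 - (norm z)\<^sup>2)" unfolding zz by simp
    then have nr: "norm (1 - cnj z * z) = 1 - (norm z)\<^sup>2"
      using z1 by (simp only: norm_of_real) (simp add: power_le_one)
    have "?D w = ((1 - cnj z * w)^2 - (cnj z * (w - z))^2) / ((w - z)^2 * (1 - cnj z * w)^2)"
      using n n1 w nz[of w] by (simp add: n_def diff_frac_eq power_divide power_mult_distrib)
    also have "(1 - cnj z * w)^2 - (cnj z * (w - z))^2 = (1 - cnj z * z) * ((1 - cnj z * w) - cnj z * (w - z))"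
      by (simp add: power2_eq_square algebra_simps)
    finally have "norm (?D w) = (1 - (norm z)\<^sup>2) * norm ((1 - cnj z * w) - cnj z * (w - z)) / (n^2 * n^2)"
      by (simp only: norm_divide norm_mult norm_power n1 n_def[symmetric] nr)
    also have "\<dots> \<le> (1 - (norm z)\<^sup>2) * (2 * n) / (n^2 * n^2)"
    proof -
      have "norm ((1 - cnj z * w) - cnj z * (w - z)) \<le> n + norm z * n"
        using norm_triangle_ineq4[of "1 - cnj z * w" "cnj z * (w - z)"] n1 by (simp add: norm_mult n_def)
      also have "norm z * n \<le> 1 * n" using z1 n by (intro mult_right_mono) auto
      finally show ?thesis using n z1 by (intro divide_right_mono mult_left_mono) (auto simp: power_le_one)
    qed
    also have "\<dots> = 2 * poisson_kernel z t / n"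
      unfolding poisson_kernel_eq[OF z1] w_def[symmetric] n_def[symmetric] using n
      by (simp add: power2_eq_square divide_simps)
    finally have D: "norm (?D w) \<le> 2 * poisson_kernel z t / n" .
    have "norm (R w) \<le> k t * norm (w - \<zeta>)" using R[of t] by (simp add: R_def w_def)
    also have "\<dots> \<le> k t * ((1 + a) * n)" by (rule mult_left_mono[OF wz k(2)])
    finally have Rn: "norm (R w) \<le> k t * ((1 + a) * n)" .
    have "norm (R w) * norm (?D w) \<le> (k t * ((1 + a) * n)) * (2 * poisson_kernel z t / n)"
      by (rule mult_mono[OF Rn D order_trans[OF norm_ge_zero Rn] norm_ge_zero])
    also have "\<dots> = 2 * (1 + a) * (poisson_kernel z t * k t)" using n by simp
    finally show ?thesis unfolding w_def[symmetric] by (simp only: norm_mult w(1) norm_ii mult_1_right)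
  qed
  have AEk: "AE t in circle. \<bar>k t\<bar> \<le> B" using k(2,3) by simp
  have "norm (LINT t|circle. R (cis t) * ?D (cis t) * (\<i> * cis t))
      \<le> (LINT t|circle. norm (R (cis t) * ?D (cis t) * (\<i> * cis t)))"
    by (rule integral_norm_bound)
  also have "\<dots> \<le> (LINT t|circle. 2 * (1 + a) * (poisson_kernel z t * k t))"
    by (intro integral_mono' integrable_mult_right integrable_herglotz_kernel_mult(2)[OF z1 k(1) AEk] pt
        order_trans[OF norm_ge_zero pt])
  also have "\<dots> = 2 * (1 + a) * (2 * pi * poisson_integral k z)" by (simp add: poisson_integral_kernel)
  finally have "norm (2 * pi * \<i> * (g z - b)) \<le> 2 * (1 + a) * (2 * pi * poisson_integral k z)"
    unfolding I .
  moreover have "norm (2 * pi * \<i> * (g z - b)) = 2 * pi * norm (g z - b)"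
    by (simp only: norm_mult norm_of_real norm_ii) simp
  moreover have "2 * (1 + a) * (2 * pi * poisson_integral k z) = 2 * pi * (2 * (1 + a) * poisson_integral k z)"
    by simp
  ultimately have "2 * pi * norm (g z - b) \<le> 2 * pi * (2 * (1 + a) * poisson_integral k z)"
    by (simp only:)
  then show ?thesis by (rule mult_left_le_imp_le) simp
qed


text \<open>The preceding estimate with \<open>k\<close> the relative error of the linear approximation on the circle: \<open>k\<close> is bounded,
  as \<open>G\<close> is Lipschitz, and tends to \<open>0\<close> at \<open>\<zeta>\<close>, so its Poisson integral tends to \<open>0\<close>.\<close>

lemma nontangential_limit_of_boundary_slope:
  fixes G g :: "complex \<Rightarrow> complex"
  assumes lipG: "C-lipschitz_on (cball 0 1) G"
    and G': "\<And>z. z \<in> ball 0 1 \<Longrightarrow> (G has_field_derivative g z) (at z)"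
    and \<zeta>: "norm \<zeta> = 1"
    and slope: "((\<lambda>w. (G w - G \<zeta>) / (w - \<zeta>)) \<longlongrightarrow> b) (at \<zeta> within sphere 0 1)"
  shows "(g \<longlongrightarrow> b) (at \<zeta> within stolz_region a \<zeta>)"
proof -
  have contG: "continuous_on (cball 0 1) G" by (rule lipschitz_on_continuous_on[OF lipG])
  define k where "k t = norm (G (cis t) - G \<zeta> - b * (cis t - \<zeta>)) / norm (cis t - \<zeta>)" for t
  have k0: "k t \<ge> 0" for t by (simp add: k_def)
  have R: "norm (G (cis t) - G \<zeta> - b * (cis t - \<zeta>)) \<le> k t * norm (cis t - \<zeta>)" for t
    by (cases "cis t = \<zeta>") (auto simp: k_def)
  have kB: "k t \<le> C + norm b" for t
  proof -
    have "norm (G (cis t) - G \<zeta>) \<le> C * norm (cis t - \<zeta>)"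
      using lipschitz_onD[OF lipG, of "cis t" \<zeta>] \<zeta> by (simp add: dist_norm)
    then have "norm (G (cis t) - G \<zeta> - b * (cis t - \<zeta>)) \<le> (C + norm b) * norm (cis t - \<zeta>)"
      using norm_triangle_ineq4[of "G (cis t) - G \<zeta>" "b * (cis t - \<zeta>)"]
      unfolding norm_mult distrib_right by linarith
    moreover have "C \<ge> 0" using lipschitz_on_nonneg[OF lipG] .
    ultimately show ?thesis unfolding k_def by (cases "cis t = \<zeta>") (auto simp: divide_le_eq)
  qed
  have km: "k \<in> borel_measurable circle"
    unfolding k_def
    by (intro borel_measurable_divide measurable_circle_continuous continuous_intros continuous_on_compose2[OF contG]) auto
  have "(poisson_integral k \<longlongrightarrow> 0) (at \<zeta> within ball 0 1)"
  proof (rule poisson_integral_tendsto[OF km _ \<zeta>])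
    show "\<bar>k t\<bar> \<le> C + norm b" for t using k0[of t] kB[of t] by simp
    fix e :: real assume "e > 0"
    then have "\<forall>\<^sub>F w in at \<zeta> within sphere 0 1. dist ((G w - G \<zeta>) / (w - \<zeta>)) b < e" by (rule tendstoD[OF slope])
    then obtain d where d: "d > 0" "\<And>w. norm w = 1 \<Longrightarrow> w \<noteq> \<zeta> \<Longrightarrow> dist w \<zeta> < d \<Longrightarrow> dist ((G w - G \<zeta>) / (w - \<zeta>)) b < e"
      unfolding eventually_at by auto
    have "\<bar>k t - 0\<bar> \<le> e" if "norm (cis t - \<zeta>) < d" for t
    proof (cases "cis t = \<zeta>")
      case True then show ?thesis using \<open>e > 0\<close> by (simp add: k_def)
    next
      case False
      have "k t = norm ((G (cis t) - G \<zeta>) / (cis t - \<zeta>) - b)"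
        unfolding k_def norm_divide[symmetric] using False by (simp add: diff_divide_distrib)
      then show ?thesis using d(2)[of "cis t"] False that k0[of t] by (simp add: dist_norm)
    qed
    then show "\<exists>d>0. \<forall>t\<in>space circle. norm (cis t - \<zeta>) < d \<longrightarrow> \<bar>k t - 0\<bar> \<le> e" using d(1) by blast
  qed
  then have "(poisson_integral k \<longlongrightarrow> 0) (at \<zeta> within stolz_region a \<zeta>)"
    by (rule tendsto_within_subset) (rule stolz_region_subset_ball)
  then have "((\<lambda>z. 2 * (1 + a) * poisson_integral k z) \<longlongrightarrow> 0) (at \<zeta> within stolz_region a \<zeta>)"
    by (rule tendsto_mult_right_zero)
  moreover have "\<forall>\<^sub>F z in at \<zeta> within stolz_region a \<zeta>. norm (g z - b) \<le> 2 * (1 + a) * poisson_integral k z"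
    unfolding eventually_at_filter
    by (intro always_eventually allI impI derivative_minus_slope_le_poisson_integral[OF contG G' \<zeta> km k0 kB R])
  ultimately have "((\<lambda>z. g z - b) \<longlongrightarrow> 0) (at \<zeta> within stolz_region a \<zeta>)"
    by (rule Lim_null_comparison[rotated])
  then show ?thesis by (simp add: LIM_zero_iff)
qed

lemma lipschitz_cis: "1-lipschitz_on UNIV cis"
proof (rule lipschitz_onI)
  fix s t :: real
  have "cis s - cis t = cis t * (cis (s - t) - 1)"
    by (simp add: right_diff_distrib cis_mult)
  moreover have "norm (cis (s - t) - 1) = 2 * \<bar>sin ((s - t) / 2)\<bar>"
    unfolding cis_conv_exp by (rule dist_exp_i_1)
  ultimately have "norm (cis s - cis t) = 2 * \<bar>sin ((s - t) / 2)\<bar>"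
    by (simp add: norm_mult)
  also have "\<dots> \<le> 2 * \<bar>(s - t) / 2\<bar>" by (intro mult_left_mono abs_sin_x_le_abs_x) simp
  finally show "dist (cis s) (cis t) \<le> 1 * dist s t" by (simp add: dist_norm)
qed simp

text \<open>A point \<open>w\<close> of the circle near \<open>cis t\<close> is \<open>cis (t + \<tau>)\<close> with \<open>\<tau> = Arg (w / cis t)\<close>; the slope is then the
  quotient of two difference quotients in \<open>\<tau>\<close>.\<close>

lemma sphere_slope_of_angular_derivative:
  fixes G :: "complex \<Rightarrow> complex"
  assumes D: "((\<lambda>h. (G (cis (t + h)) - G (cis t)) / of_real h) \<longlongrightarrow> D) (at 0)"
  shows "((\<lambda>w. (G w - G (cis t)) / (w - cis t)) \<longlongrightarrow> D / (\<i> * cis t)) (at (cis t) within sphere 0 1)"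
proof -
  define \<tau> where "\<tau> w = Arg (w / cis t)" for w
  have cis_tau: "cis (t + \<tau> w) = w" if "norm w = 1" for w
  proof -
    have "w \<noteq> 0" using that by auto
    then have "cis (\<tau> w) = w / cis t"
      unfolding \<tau>_def using that by (subst cis_Arg) (auto simp: sgn_div_norm norm_divide)
    then show ?thesis by (simp flip: cis_mult)
  qed
  have "((\<lambda>w. w / cis t) \<longlongrightarrow> cis t / cis t) (at (cis t) within sphere 0 1)"
    by (intro tendsto_intros) simp
  then have "(\<tau> \<longlongrightarrow> Arg 1) (at (cis t) within sphere 0 1)"
    unfolding \<tau>_def by (intro isCont_tendsto_compose[OF continuous_at_Arg]) simp_all
  moreover have ne: "\<forall>\<^sub>F w in at (cis t) within sphere 0 1. cis (t + \<tau> w) = w \<and> \<tau> w \<noteq> 0"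
    unfolding eventually_at_filter
  proof (intro always_eventually allI impI)
    fix w assume "w \<noteq> cis t" "w \<in> sphere 0 1"
    then show "cis (t + \<tau> w) = w \<and> \<tau> w \<noteq> 0"
      using cis_tau[of w] by (cases "\<tau> w = 0") auto
  qed
  ultimately have tau: "filterlim \<tau> (at 0) (at (cis t) within sphere 0 1)"
    unfolding filterlim_at by (auto elim: eventually_mono)
  have cis': "((\<lambda>h. (cis (t + h) - cis t) / of_real h) \<longlongrightarrow> \<i> * cis t) (at 0)"
    using DERIV_cos[of t] DERIV_sin[of t] by (simp add: tendsto_complex_iff DERIV_def)
  have "((\<lambda>w. ((G (cis (t + \<tau> w)) - G (cis t)) / of_real (\<tau> w)) / ((cis (t + \<tau> w) - cis t) / of_real (\<tau> w)))
      \<longlongrightarrow> D / (\<i> * cis t)) (at (cis t) within sphere 0 1)"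
    by (intro tendsto_divide filterlim_compose[OF D tau] filterlim_compose[OF cis' tau]) simp
  moreover have "\<forall>\<^sub>F w in at (cis t) within sphere 0 1.
     ((G (cis (t + \<tau> w)) - G (cis t)) / of_real (\<tau> w)) / ((cis (t + \<tau> w) - cis t) / of_real (\<tau> w))
       = (G w - G (cis t)) / (w - cis t)"
    using ne by eventually_elim simp
  ultimately show ?thesis by (rule Lim_transform_eventually)
qed

lemma negligible_imp_AE_circle:
  assumes "negligible N"
  shows "AE t in circle. t \<notin> N"
proof -
  have "AE t in lebesgue. t \<notin> N" using assms by (simp add: negligible_iff_null_sets AE_not_in)
  then have "AE t in lebesgue. t \<in> {0..<2 * pi} \<longrightarrow> t \<notin> N" by eventually_elim simp
  then show ?thesis unfolding circle_def by (subst AE_restrict_space_iff) auto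
qed

text \<open>A primitive of \<open>g\<close> is Lipschitz, so it extends to the closed disk and its boundary function is
  differentiable almost everywhere.  At a point of differentiability \<open>g\<close> has a nontangential limit.\<close>

lemma bounded_holomorphic_nontangential_limit:
  assumes hol: "g holomorphic_on ball 0 1" and bound: "\<And>z. z \<in> ball 0 1 \<Longrightarrow> norm (g z) \<le> B"
  shows "AE t in circle. \<exists>b. \<forall>a. (g \<longlongrightarrow> b) (at (cis t) within stolz_region a (cis t))"
proof -
  have "g field_differentiable at x" if "x \<in> interior (ball 0 1) - {}" for x
    using that hol by (auto simp: holomorphic_on_imp_differentiable_at)
  then obtain G0 where G0: "\<And>x. x \<in> ball 0 1 \<Longrightarrow> (G0 has_field_derivative g x) (at x within ball 0 1)"
    using holomorphic_convex_primitive[of "ball 0 1" "{}" g] holomorphic_on_imp_continuous_on[OF hol] by auto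
  have B0: "B \<ge> 0" using bound[of 0] by (auto intro: order_trans[OF norm_ge_zero])
  have "B-lipschitz_on (ball 0 1) G0"
  proof (rule lipschitz_onI[OF _ B0])
    fix x y :: complex assume "x \<in> ball 0 1" "y \<in> ball 0 1"
    then show "dist (G0 x) (G0 y) \<le> B * dist x y"
      using field_differentiable_bound[OF convex_ball G0 bound] by (simp add: dist_norm)
  qed
  then obtain G where lip: "B-lipschitz_on (cball 0 1) G" and eq: "\<And>x. x \<in> ball 0 1 \<Longrightarrow> G x = G0 x"
    using lipschitz_extend_closure[of B "ball 0 1" G0] by auto
  have G': "(G has_field_derivative g z) (at z)" if "z \<in> ball 0 1" for z
  proof -
    have "(G0 has_field_derivative g z) (at z)" using G0[OF that] that at_within_open[of z "ball 0 1"] by simp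
    then show ?thesis
      by (rule has_field_derivative_transform_within_open[OF _ open_ball that]) (simp add: eq)
  qed
  have lipc: "B-lipschitz_on UNIV (\<lambda>t. G (cis t))"
  proof -
    have "(B * 1)-lipschitz_on UNIV (\<lambda>t. G (cis t))"
      by (rule lipschitz_on_compose2[OF lipschitz_cis lipschitz_on_subset[OF lip]]) auto
    then show ?thesis by simp
  qed
  have "B-lipschitz_on UNIV (\<lambda>t. Re (G (cis t)))" "B-lipschitz_on UNIV (\<lambda>t. Im (G (cis t)))"
    using lipc unfolding lipschitz_on_def dist_norm real_norm_def
    by (auto simp flip: minus_complex.simps intro: order_trans[OF abs_Re_le_cmod] order_trans[OF abs_Im_le_cmod])
  then obtain N1 N2 where N: "negligible N1" "negligible N2"
    "\<And>x. x \<notin> N1 \<Longrightarrow> \<exists>D. ((\<lambda>t. Re (G (cis t))) has_real_derivative D) (at x)"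
    "\<And>x. x \<notin> N2 \<Longrightarrow> \<exists>D. ((\<lambda>t. Im (G (cis t))) has_real_derivative D) (at x)"
    using lipschitz_real_differentiable_AE by metis
  have "\<exists>b. \<forall>a. (g \<longlongrightarrow> b) (at (cis t) within stolz_region a (cis t))" if t: "t \<notin> N1 \<union> N2" for t
  proof -
    obtain D1 D2 where "((\<lambda>t. Re (G (cis t))) has_real_derivative D1) (at t)"
      "((\<lambda>t. Im (G (cis t))) has_real_derivative D2) (at t)" using N(3)[of t] N(4)[of t] t by blast
    then have "((\<lambda>h. (G (cis (t + h)) - G (cis t)) / of_real h) \<longlongrightarrow> Complex D1 D2) (at 0)"
      by (simp add: tendsto_complex_iff DERIV_def)
    from nontangential_limit_of_boundary_slope[OF lip G' norm_cis sphere_slope_of_angular_derivative[OF this]]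
    show ?thesis by blast
  qed
  moreover have "AE t in circle. t \<notin> N1 \<union> N2"
    using N(1,2) by (intro negligible_imp_AE_circle) simp
  ultimately show ?thesis by (auto elim: eventually_mono)
qed

text \<open>One fixed sequence of radii is enough to describe boundary values, and countability is what measurability and
  dominated convergence ask for.  The shift by two keeps the radii positive.\<close>

definition radius :: "nat \<Rightarrow> real" where "radius n = 1 - 1 / real (n + 2)"

lemma radius_bounds: "0 < radius n" "radius n < 1" by (auto simp: radius_def)

lemma radius_tendsto: "radius \<longlonglongrightarrow> 1"
proof -
  have "radius \<longlonglongrightarrow> 1 - 0"
    unfolding radius_def by (intro tendsto_diff tendsto_const LIMSEQ_ignore_initial_segment[OF lim_1_over_n, where k = 2])
  then show ?thesis by simp
qed

lemma norm_radius_mult: "norm (of_real (radius n) * z) = radius n * norm (z :: complex)"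
  unfolding norm_mult norm_of_real using radius_bounds[of n] by simp

lemma radius_mult_in_ball:
  assumes "norm (z :: complex) \<le> 1"
  shows "of_real (radius n) * z \<in> ball 0 1"
proof -
  have "radius n * norm z \<le> radius n * 1" using assms radius_bounds[of n] by (intro mult_left_mono) auto
  then show ?thesis using radius_bounds[of n] unfolding mem_ball_0 norm_radius_mult by linarith
qed

lemma radial_approach_stolz:
  assumes "a > 1"
  shows "filterlim (\<lambda>n. of_real (radius n) * cis t) (at (cis t) within stolz_region a (cis t)) sequentially"
proof -
  have "(\<lambda>n. of_real (radius n) * cis t) \<longlonglongrightarrow> of_real 1 * cis t"
    by (intro tendsto_mult[OF tendsto_of_real tendsto_const] radius_tendsto)
  moreover have "of_real (radius n) * cis t \<in> stolz_region a (cis t) - {cis t}" for n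
  proof -
    note r = radius_bounds[of n]
    have "norm (cis t - of_real (radius n) * cis t) = norm (of_real (1 - radius n) * cis t)" by (simp add: algebra_simps)
    also have "\<dots> = 1 - radius n" unfolding norm_mult norm_of_real using r by simp
    finally have 1: "norm (cis t - of_real (radius n) * cis t) = 1 - radius n" .
    have 2: "norm (of_real (radius n) * cis t) = radius n" using norm_radius_mult[of n "cis t"] by simp
    have "1 * (1 - radius n) < a * (1 - radius n)" using r assms by (intro mult_strict_right_mono) auto
    moreover have "of_real (radius n) * cis t \<noteq> cis t" using 1 r by auto
    ultimately show ?thesis using 1 2 r by (simp add: stolz_region_def)
  qed
  ultimately show ?thesis unfolding filterlim_at by auto
qed

lemma radial_approach_ball:
  "filterlim (\<lambda>n. of_real (radius n) * cis t) (at (cis t) within ball 0 1) sequentially"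
  using radial_approach_stolz[of 2 t] at_le[OF stolz_region_subset_ball]
  by (auto intro: filterlim_mono)

lemma at_within_stolz_ne_bot:
  assumes "a > 1"
  shows "at (cis t) within stolz_region a (cis t) \<noteq> bot"
proof
  assume "at (cis t) within stolz_region a (cis t) = bot"
  then have "filterlim (\<lambda>n. of_real (radius n) * cis t) bot sequentially" using radial_approach_stolz[OF assms, of t] by simp
  then show False by (simp add: filterlim_def bot.extremum_unique filtermap_bot_iff)
qed

text \<open>Near \<open>\<zeta>\<close> the values \<open>exp (F z) / b\<close> avoid the slit of the principal logarithm.  The difference of \<open>F\<close> and
  this logarithm is continuous with values in a translate of \<open>2 \<pi> i \<int>\<close>, so on a connected set it is constant.\<close>

lemma tendsto_of_tendsto_exp:
  fixes F :: "complex \<Rightarrow> complex"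
  assumes cont: "continuous_on S F" and conv: "convex S" and "\<zeta> \<notin> S"
    and lim: "((\<lambda>z. exp (F z)) \<longlongrightarrow> b) (at \<zeta> within S)" and "b \<noteq> 0"
  shows "\<exists>l. (F \<longlongrightarrow> l) (at \<zeta> within S)"
proof -
  have "norm b > 0" using \<open>b \<noteq> 0\<close> by simp
  then have "\<forall>\<^sub>F z in at \<zeta> within S. dist (exp (F z)) b < norm b" by (rule tendstoD[OF lim])
  then obtain d where d: "d > 0" "\<And>z. z \<in> S \<Longrightarrow> z \<noteq> \<zeta> \<Longrightarrow> dist z \<zeta> < d \<Longrightarrow> dist (exp (F z)) b < norm b"
    unfolding eventually_at by auto
  define T where "T = S \<inter> ball \<zeta> d"
  have T: "connected T" unfolding T_def by (intro convex_connected convex_Int conv convex_ball)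
  define L where "L z = Ln (exp (F z) / b)" for z
  have slit: "exp (F z) / b \<notin> \<real>\<^sub>\<le>\<^sub>0" if "z \<in> T" for z
  proof
    assume "exp (F z) / b \<in> \<real>\<^sub>\<le>\<^sub>0"
    then have "Re (exp (F z) / b) \<le> 0" by (simp add: complex_nonpos_Reals_iff)
    have "dist (exp (F z)) b < norm b"
      using that \<open>\<zeta> \<notin> S\<close> by (intro d(2)) (auto simp: T_def dist_commute)
    moreover have "exp (F z) / b - 1 = (exp (F z) - b) / b"
      using \<open>b \<noteq> 0\<close> by (simp add: diff_divide_distrib)
    ultimately have "norm (exp (F z) / b - 1) < 1"
      using \<open>norm b > 0\<close> by (simp add: dist_norm norm_divide divide_less_eq)
    moreover have "1 - Re (exp (F z) / b) \<le> norm (exp (F z) / b - 1)"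
      using abs_Re_le_cmod[of "exp (F z) / b - 1"] by simp
    ultimately show False using \<open>Re (exp (F z) / b) \<le> 0\<close> by linarith
  qed
  have expL: "exp (F z - L z) = b" if "z \<in> T" for z
    using \<open>b \<noteq> 0\<close> by (simp add: exp_diff L_def)
  have "(\<lambda>z. F z - L z) constant_on T"
  proof (rule continuous_discrete_range_constant[OF T])
    show "continuous_on T (\<lambda>z. F z - L z)"
      unfolding L_def using slit \<open>b \<noteq> 0\<close>
      by (intro continuous_intros continuous_on_subset[OF cont]) (auto simp: T_def)
    fix x assume x: "x \<in> T"
    have "1 \<le> norm ((F y - L y) - (F x - L x))" if y: "y \<in> T" "F y - L y \<noteq> F x - L x" for y
    proof -
      have "exp (F y - L y) = exp (F x - L x)" using expL x y by simp
      then obtain n :: int where n: "F y - L y = F x - L x + (of_int (2 * n) * pi) * \<i>" unfolding exp_eq by blast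
      then have "n \<noteq> 0" using y by auto
      have "norm ((F y - L y) - (F x - L x)) = 2 * (\<bar>real_of_int n\<bar> * pi)" unfolding n by (simp add: norm_mult)
      moreover have "1 * 1 \<le> \<bar>real_of_int n\<bar> * pi" using \<open>n \<noteq> 0\<close> pi_gt3 by (intro mult_mono) auto
      ultimately show ?thesis by linarith
    qed
    then show "\<exists>e>0. \<forall>y. y \<in> T \<and> F y - L y \<noteq> F x - L x \<longrightarrow> e \<le> norm ((F y - L y) - (F x - L x))"
      by (intro exI[of _ 1]) auto
  qed
  then obtain c where c: "\<And>z. z \<in> T \<Longrightarrow> F z - L z = c" unfolding constant_on_def by blast
  have "((\<lambda>z. exp (F z) / b) \<longlongrightarrow> b / b) (at \<zeta> within S)" by (intro tendsto_intros lim \<open>b \<noteq> 0\<close>)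
  then have "(L \<longlongrightarrow> Ln 1) (at \<zeta> within S)"
    unfolding L_def using \<open>b \<noteq> 0\<close> by (intro tendsto_Ln) simp_all
  then have "((\<lambda>z. c + L z) \<longlongrightarrow> c + Ln 1) (at \<zeta> within S)" by (intro tendsto_intros)
  moreover have "\<forall>\<^sub>F z in at \<zeta> within S. c + L z = F z"
    unfolding eventually_at using d(1) c by (intro exI[of _ d]) (auto simp: T_def dist_commute algebra_simps)
  ultimately show ?thesis by (metis Lim_transform_eventually)
qed

text \<open>The bounded function \<open>exp F\<close> has nontangential limits, which are nonzero because \<open>Re F\<close> is bounded
  below; in each Stolz region the logarithm can be taken.  The limit does not depend on the aperture,
  since Stolz regions with the same vertex are nested.\<close>

lemma nontangential_limit_of_bounded_Re:
  assumes hol: "F holomorphic_on ball 0 1" and Re: "\<And>z. z \<in> ball 0 1 \<Longrightarrow> \<bar>Re (F z)\<bar> \<le> M"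
  shows "AE t in circle. \<exists>l. \<forall>a>1. (F \<longlongrightarrow> l) (at (cis t) within stolz_region a (cis t))"
proof -
  have "AE t in circle. \<exists>b. \<forall>a. ((\<lambda>z. exp (F z)) \<longlongrightarrow> b) (at (cis t) within stolz_region a (cis t))"
  proof (rule bounded_holomorphic_nontangential_limit)
    show "(\<lambda>z. exp (F z)) holomorphic_on ball 0 1" by (intro holomorphic_intros hol)
    show "norm (exp (F z)) \<le> exp M" if "z \<in> ball 0 1" for z using Re[OF that] by simp
  qed
  then show ?thesis
  proof eventually_elim
    case (elim t)
    then obtain b where b: "\<And>a. ((\<lambda>z. exp (F z)) \<longlongrightarrow> b) (at (cis t) within stolz_region a (cis t))" by blast
    have bot: "at (cis t) within stolz_region a (cis t) \<noteq> bot" if "a > 1" for a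
      by (rule at_within_stolz_ne_bot[OF that])
    have "exp (- M) \<le> norm b"
    proof (rule tendsto_lowerbound[OF tendsto_norm[OF b[of 2]] _ bot])
      show "\<forall>\<^sub>F z in at (cis t) within stolz_region 2 (cis t). exp (- M) \<le> norm (exp (F z))"
        unfolding eventually_at_filter using Re stolz_region_subset_ball[of 2 "cis t"]
        by (intro always_eventually) (auto simp: abs_le_iff minus_le_iff)
    qed simp
    then have "b \<noteq> 0" using exp_gt_zero[of "- M"] by (auto simp del: exp_gt_zero)
    have ex: "\<exists>l. (F \<longlongrightarrow> l) (at (cis t) within stolz_region a (cis t))" if "a > 1" for a
    proof (rule tendsto_of_tendsto_exp[OF _ _ _ b \<open>b \<noteq> 0\<close>])
      show "continuous_on (stolz_region a (cis t)) F"
        by (rule continuous_on_subset[OF holomorphic_on_imp_continuous_on[OF hol] stolz_region_subset_ball])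
      show "convex (stolz_region a (cis t))" using that by (intro convex_stolz_region) simp
      show "cis t \<notin> stolz_region a (cis t)" by (simp add: stolz_region_def)
    qed
    then obtain l where l: "(F \<longlongrightarrow> l) (at (cis t) within stolz_region 2 (cis t))" by force
    have mono: "stolz_region a (cis t) \<subseteq> stolz_region a' (cis t)" if "a \<le> a'" for a a'
      using that by (auto simp: stolz_region_def intro: order_less_le_trans mult_right_mono)
    have "(F \<longlongrightarrow> l) (at (cis t) within stolz_region a (cis t))" if a: "a > 1" for a
    proof (cases "a \<le> 2")
      case True then show ?thesis using tendsto_within_subset[OF l mono] by blast
    next
      case False
      obtain l' where l': "(F \<longlongrightarrow> l') (at (cis t) within stolz_region a (cis t))" using ex[OF a] by blast
      then have "(F \<longlongrightarrow> l') (at (cis t) within stolz_region 2 (cis t))"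
        using False by (intro tendsto_within_subset[OF l' mono]) simp
      then have "l' = l" using l bot[of 2] tendsto_unique[of _ F] by auto
      then show ?thesis using l' by simp
    qed
    then show ?case by blast
  qed
qed

section \<open>Boundary values of a Poisson integral and its conjugate\<close>

text \<open>Completeness turns almost everywhere equality into measurability, which the conjugate function
  needs: it is a radial limit off a null set and is assigned values by fiat on that null set.\<close>

lemma complete_measure_circle: "complete_measure circle"
proof
  fix A B assume "B \<subseteq> A" "A \<in> null_sets circle"
  then have "A \<subseteq> {0..<2*pi}" "A \<in> null_sets lebesgue"
    unfolding circle_def by (auto simp: null_sets_restrict_space)
  then have "B \<in> null_sets lebesgue" "B \<subseteq> {0..<2*pi}" using \<open>B \<subseteq> A\<close> completion.complete2 by auto
  then have "B \<in> null_sets circle" unfolding circle_def by (simp add: null_sets_restrict_space)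
  then show "B \<in> sets circle" by auto
qed

lemma borel_measurable_circle_AE:
  fixes f g :: "real \<Rightarrow> real"
  assumes f: "f \<in> borel_measurable circle" and eq: "AE t in circle. f t = g t"
  shows "g \<in> borel_measurable circle"
proof (rule measurableI)
  fix A :: "real set" assume A: "A \<in> sets borel"
  show "g -` A \<inter> space circle \<in> sets circle"
  proof (rule complete_measure.in_sets_AE[OF complete_measure_circle])
    show "AE x in circle. x \<in> f -` A \<inter> space circle \<longleftrightarrow> x \<in> g -` A \<inter> space circle"
      using eq by eventually_elim auto
    show "f -` A \<inter> space circle \<in> sets circle" by (rule measurable_sets[OF f A])
  qed auto
qed simp

text \<open>The chosen conjugate makes a holomorphic function with \<open>u\<close>; the Herglotz integral witnesses that the choice
  is not vacuous, being real at \<open>0\<close>.\<close>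

lemma normalized_harmonic_conjugate_poisson:
  assumes h: "h \<in> borel_measurable circle" "AE t in circle. \<bar>h t\<bar> \<le> B"
  defines "v \<equiv> normalized_harmonic_conjugate (poisson_integral h)"
  shows "(\<lambda>z. Complex (poisson_integral h z) (v z)) holomorphic_on ball 0 1"
proof -
  let ?v = "\<lambda>z. Im (herglotz_integral h z)"
  have "(\<lambda>z. complex_of_real (poisson_integral h z) + \<i> * complex_of_real (?v z)) holomorphic_on ball 0 1"
  proof (rule holomorphic_transform[OF holomorphic_herglotz_integral[OF h]])
    fix z :: complex assume "z \<in> ball 0 1"
    then have "poisson_integral h z = Re (herglotz_integral h z)" using Re_herglotz_integral[OF _ h, of z] by simp
    then show "herglotz_integral h z = complex_of_real (poisson_integral h z) + \<i> * complex_of_real (?v z)"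
      by (simp only: complex_eq[symmetric])
  qed
  moreover have "?v 0 = 0"
    unfolding herglotz_integral_def by (simp add: Im_divide_of_real)
  ultimately have "\<exists>v. harmonic_conjugate_of (poisson_integral h) v \<and> v 0 = 0"
    unfolding harmonic_conjugate_of_def by (intro exI[of _ ?v] conjI)
  then have "harmonic_conjugate_of (poisson_integral h) v \<and> v 0 = 0"
    unfolding v_def normalized_harmonic_conjugate_def by (rule someI_ex)
  then show ?thesis unfolding harmonic_conjugate_of_def by (simp only: Complex_eq)
qed

text \<open>Where \<open>u + i v\<close> has a nontangential limit, the imaginary part of this limit is the only candidate in the
  definition of the conjugate function, and the radius lies in every Stolz region.\<close>

lemma conjugate_function_radial_limit:
  assumes h: "h \<in> borel_measurable circle" "AE t in circle. \<bar>h t\<bar> \<le> B"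
  shows "AE t in circle. (\<lambda>n. normalized_harmonic_conjugate (poisson_integral h) (of_real (radius n) * cis t))
           \<longlonglongrightarrow> conjugate_function h t"
    and "AE t in circle. \<exists>l. (\<lambda>n. poisson_integral h (of_real (radius n) * cis t)) \<longlonglongrightarrow> l"
proof -
  define v where "v = normalized_harmonic_conjugate (poisson_integral h)"
  define F where "F z = Complex (poisson_integral h z) (v z)" for z
  have holF: "F holomorphic_on ball 0 1"
    unfolding F_def v_def by (rule normalized_harmonic_conjugate_poisson[OF h])
  have "\<bar>Re (F z)\<bar> \<le> B" if "z \<in> ball 0 1" for z
    using poisson_integral_abs_le[OF _ h, of z] that by (simp add: F_def)
  from nontangential_limit_of_bounded_Re[OF holF this]
  have lim: "AE t in circle. \<exists>l. \<forall>a>1. (F \<longlongrightarrow> l) (at (cis t) within stolz_region a (cis t))" .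
  from lim show "AE t in circle. \<exists>l. (\<lambda>n. poisson_integral h (of_real (radius n) * cis t)) \<longlonglongrightarrow> l"
  proof eventually_elim
    case (elim t)
    then obtain l where "(F \<longlongrightarrow> l) (at (cis t) within stolz_region 2 (cis t))" by force
    from tendsto_Re[OF filterlim_compose[OF this radial_approach_stolz]]
    show ?case by (auto simp: F_def)
  qed
  from lim show "AE t in circle. (\<lambda>n. normalized_harmonic_conjugate (poisson_integral h) (of_real (radius n) * cis t))
           \<longlonglongrightarrow> conjugate_function h t"
  proof eventually_elim
    case (elim t)
    then obtain l where l: "\<And>a. a > 1 \<Longrightarrow> (F \<longlongrightarrow> l) (at (cis t) within stolz_region a (cis t))" by blast
    have "has_nontangential_limit v (cis t) (Im l)"
      unfolding has_nontangential_limit_def using tendsto_Im[OF l] by (simp add: F_def)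
    moreover have "x = y" if "has_nontangential_limit v (cis t) x" "has_nontangential_limit v (cis t) y" for x y
    proof (rule tendsto_unique[OF at_within_stolz_ne_bot[of 2 t]])
      show "(v \<longlongrightarrow> x) (at (cis t) within stolz_region 2 (cis t))" "(v \<longlongrightarrow> y) (at (cis t) within stolz_region 2 (cis t))"
        using that unfolding has_nontangential_limit_def by auto
    qed simp_all
    ultimately have "(THE l. has_nontangential_limit v (cis t) l) = Im l"
      "\<exists>l. has_nontangential_limit v (cis t) l" by blast+
    then have "conjugate_function h t = Im l"
      unfolding conjugate_function_def v_def[symmetric] Let_def by simp
    moreover have "(\<lambda>n. v (of_real (radius n) * cis t)) \<longlonglongrightarrow> Im l"
      using tendsto_Im[OF filterlim_compose[OF l[of 2] radial_approach_stolz]] by (simp add: F_def)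
    ultimately show ?case by (simp add: v_def)
  qed
qed

lemma continuous_on_radial:
  assumes "continuous_on (ball 0 1) w"
  shows "continuous_on UNIV (\<lambda>t. w (of_real (radius n) * cis t))"
  by (rule continuous_on_compose2[OF assms])
     (use radius_mult_in_ball in \<open>auto intro!: continuous_intros\<close>)

lemma measurable_conjugate_function:
  assumes h: "h \<in> borel_measurable circle" "AE t in circle. \<bar>h t\<bar> \<le> B"
  shows "conjugate_function h \<in> borel_measurable circle"
proof (rule borel_measurable_circle_AE)
  let ?v = "normalized_harmonic_conjugate (poisson_integral h)"
  have "continuous_on (ball 0 1) ?v"
    using continuous_on_Im[OF holomorphic_on_imp_continuous_on[OF normalized_harmonic_conjugate_poisson[OF h]]] by simp
  then show "(\<lambda>t. lim (\<lambda>n. ?v (of_real (radius n) * cis t))) \<in> borel_measurable circle"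
    by (intro borel_measurable_lim_metric measurable_circle_continuous continuous_on_radial)
  show "AE t in circle. lim (\<lambda>n. ?v (of_real (radius n) * cis t)) = conjugate_function h t"
    using conjugate_function_radial_limit(1)[OF h] by eventually_elim (rule limI)
qed

lemma poisson_integral_cong_AE:
  assumes "h \<in> borel_measurable circle" "k \<in> borel_measurable circle" "AE t in circle. h t = k t" "norm z < 1"
  shows "poisson_integral h z = poisson_integral k z"
  unfolding poisson_integral_kernel
  using assms(1,2) measurable_poisson_kernel[OF assms(4)] assms(3)
  by (intro arg_cong[where f = "\<lambda>x. 1 / (2 * pi) * x"] integral_cong_AE) (auto elim: eventually_mono)

lemma poisson_kernel_symmetric:
  assumes "0 \<le> r" "r < 1"
  shows "poisson_kernel (of_real r * cis s) t = poisson_kernel (of_real r * cis t) s"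
proof -
  have n: "norm (of_real r * cis s) = r" for s using assms by (simp add: norm_mult)
  have "norm (cis t - of_real r * cis s) = norm (cis s - of_real r * cis t)"
  proof -
    have "(norm (cis t - of_real r * cis s))\<^sup>2 = (norm (cis s - of_real r * cis t))\<^sup>2"
    proof -
      have "(norm (cis t - of_real r * cis s))\<^sup>2 = 1 + r\<^sup>2 - 2 * r * (cos t * cos s + sin t * sin s)" for s t
      proof -
        have "(x - r * y)\<^sup>2 + (z - r * w)\<^sup>2 = (x\<^sup>2 + z\<^sup>2) + r\<^sup>2 * (y\<^sup>2 + w\<^sup>2) - 2 * r * (x * y + z * w)" for x y z w :: real
          by (simp add: power2_eq_square algebra_simps)
        from this[of "cos t" "cos s" "sin t" "sin s"] show ?thesis unfolding cmod_power2 by simp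
      qed
      then show ?thesis by (simp add: mult.commute)
    qed
    then show ?thesis by (simp add: power2_eq_iff_nonneg)
  qed
  then show ?thesis using assms by (simp add: poisson_kernel_eq n)
qed

text \<open>The operator that takes a function to its Poisson integral on the circle of radius \<open>r\<close> is self-adjoint,
  because its kernel is symmetric.\<close>

lemma circle_LINT_poisson_duality:
  assumes h: "h \<in> borel_measurable circle" "\<And>t. \<bar>h t\<bar> \<le> B"
    and k: "k \<in> borel_measurable circle" "\<And>t. \<bar>k t\<bar> \<le> B'"
    and r: "0 \<le> r" "r < 1"
  shows "(LINT t|circle. k t * poisson_integral h (of_real r * cis t))
       = (LINT s|circle. h s * poisson_integral k (of_real r * cis s))"
proof -
  interpret pair_sigma_finite circle circle
    by (intro pair_sigma_finite.intro circle.sigma_finite_measure_axioms)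
  have fin: "finite_measure (circle \<Otimes>\<^sub>M circle)"
    by (intro finite_measure_pair_measure finite_measure_circle)
  have n: "norm (of_real r * cis s) < 1" for s using r by (simp add: norm_mult)
  have [measurable]: "h \<in> borel_measurable circle" "k \<in> borel_measurable circle" "cis \<in> borel_measurable circle"
    using h(1) k(1) measurable_circle_continuous[OF continuous_on_cis[OF continuous_on_id]] by simp_all
  define g where "g t s = k t * (poisson_kernel (of_real r * cis t) s * h s)" for t s
  have "case_prod g \<in> borel_measurable (circle \<Otimes>\<^sub>M circle)"
    unfolding g_def poisson_kernel_def split_beta' by measurable
  moreover have "norm (g t s) \<le> \<bar>B'\<bar> * ((1 + r) / (1 - r) * \<bar>B\<bar>)" for t s
  proof -
    have "poisson_kernel (of_real r * cis t) s \<le> (1 + r) / (1 - r)"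
      using poisson_kernel_le[OF n[of t], of s] r by (simp add: norm_mult)
    then show ?thesis
      using h(2)[of s] k(2)[of t] poisson_kernel_nonneg[OF n[of t], of s] r
      unfolding g_def real_norm_def abs_mult by (intro mult_mono) auto
  qed
  ultimately have "integrable (circle \<Otimes>\<^sub>M circle) (case_prod g)"
    by (intro finite_measure.integrable_const_bound[OF fin, where B = "\<bar>B'\<bar> * ((1 + r) / (1 - r) * \<bar>B\<bar>)"]) auto
  from Fubini_integral[OF this]
  have "(LINT s|circle. LINT t|circle. g t s) = (LINT t|circle. LINT s|circle. g t s)" .
  moreover have "(LINT s|circle. g t s) = 2 * pi * (k t * poisson_integral h (of_real r * cis t))" for t
    by (simp add: g_def poisson_integral_kernel)
  moreover have "(LINT t|circle. g t s) = 2 * pi * (h s * poisson_integral k (of_real r * cis s))" for s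
  proof -
    have "g t s = h s * (poisson_kernel (of_real r * cis s) t * k t)" for t
      using poisson_kernel_symmetric[OF r, of t s] by (simp add: g_def)
    then show ?thesis by (simp add: poisson_integral_kernel)
  qed
  ultimately show ?thesis by simp
qed

text \<open>Away from the endpoint \<open>0\<close> the parametrization of the circle has a continuous inverse.\<close>

lemma cis_near_imp_near:
  assumes "0 < s" "s < 2 * pi" "e > 0"
  shows "\<exists>d>0. \<forall>t\<in>space circle. norm (cis t - cis s) < d \<longrightarrow> \<bar>t - s\<bar> < e"
proof -
  have A: "Arg2pi (cis t) = t" if "0 \<le> t" "t < 2 * pi" for t
    using that Arg2pi_unique[of 1 t "cis t"] by (simp add: cis_conv_exp)
  have "cis s \<notin> \<real>\<^sub>\<ge>\<^sub>0"
  proof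
    assume "cis s \<in> \<real>\<^sub>\<ge>\<^sub>0"
    then have "Arg2pi (cis s) = 0" by (simp add: Arg2pi_eq_0 complex_nonneg_Reals_iff complex_is_Real_iff)
    then show False using A[of s] assms by simp
  qed
  from continuous_at_Arg2pi[OF this] \<open>e > 0\<close>
  obtain d where d: "d > 0" "\<And>w. dist w (cis s) < d \<Longrightarrow> dist (Arg2pi w) (Arg2pi (cis s)) < e"
    unfolding continuous_at_eps_delta by blast
  then show ?thesis using A assms by (intro exI[of _ d]) (auto simp: dist_norm, metis)
qed


text \<open>The radial limit \<open>u\<close> is known to exist.  Testing against the indicator of an interval and moving the
  Poisson operator over to the indicator, where the approximate identity determines the limit at every point but
  three, shows that \<open>u\<close> and \<open>h\<close> have the same integral over every interval.  Then they agree almost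
  everywhere by Lebesgue's differentiation theorem.\<close>

lemma poisson_integral_radial_limit_of_bounded:
  assumes h: "h \<in> borel_measurable circle" "\<And>t. \<bar>h t\<bar> \<le> B"
  shows "AE t in circle. (\<lambda>n. poisson_integral h (of_real (radius n) * cis t)) \<longlonglongrightarrow> h t"
proof -
  let ?u = "\<lambda>n t. poisson_integral h (of_real (radius n) * cis t)"
  define u where "u t = lim (\<lambda>n. ?u n t)" for t
  have AEh: "AE t in circle. \<bar>h t\<bar> \<le> B" using h(2) by simp
  have lim: "AE t in circle. (\<lambda>n. ?u n t) \<longlonglongrightarrow> u t"
    using conjugate_function_radial_limit(2)[OF h(1) AEh] unfolding u_def
    by eventually_elim (metis limI)
  have nr: "norm (of_real (radius n) * cis t) < 1" for n t
    using radius_bounds[of n] by (simp only: norm_radius_mult norm_cis mult_1_right)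
  have ub: "\<bar>?u n t\<bar> \<le> B" for n t by (rule poisson_integral_abs_le[OF nr h(1) AEh])
  have contu: "continuous_on (ball 0 1) (poisson_integral h)"
    using continuous_on_Re[OF holomorphic_on_imp_continuous_on[OF normalized_harmonic_conjugate_poisson[OF h(1) AEh]]] by simp
  have um [measurable]: "?u n \<in> borel_measurable circle" for n
    by (intro measurable_circle_continuous continuous_on_radial contu)
  have [measurable]: "u \<in> borel_measurable circle" unfolding u_def by (intro borel_measurable_lim_metric um)
  have uB: "AE t in circle. \<bar>u t\<bar> \<le> B"
    using lim
  proof eventually_elim
    case (elim t)
    show ?case by (rule tendsto_upperbound[OF tendsto_rabs[OF elim]]) (use ub in auto)
  qed
  have [measurable]: "h \<in> borel_measurable circle" by fact
  have B0: "B \<ge> 0" using h(2)[of 0] by linarith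
  \<comment> \<open>Both sides are limits of the same sequence, by the duality of the Poisson operator.\<close>
  have weak: "(LINT t|circle. indicator {a..b} t * u t) = (LINT t|circle. indicator {a..b} t * h t)" for a b :: real
  proof -
    let ?k = "indicator {a..b} :: real \<Rightarrow> real"
    have k: "?k \<in> borel_measurable circle" "\<And>t. \<bar>?k t\<bar> \<le> 1"
      unfolding circle_def by (intro measurable_restrict_space1 borel_measurable_indicator) (simp_all add: indicator_def)
    then have [measurable]: "?k \<in> borel_measurable circle" by blast
    have "(\<lambda>n. LINT t|circle. ?k t * ?u n t) \<longlonglongrightarrow> (LINT t|circle. ?k t * u t)"
    proof (rule integral_dominated_convergence[where w = "\<lambda>_. B"])
      show "AE t in circle. (\<lambda>n. ?k t * ?u n t) \<longlonglongrightarrow> ?k t * u t"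
        using lim by eventually_elim (intro tendsto_intros)
      show "AE t in circle. norm (?k t * ?u n t) \<le> B" for n
        using ub[of n] B0 by (intro AE_I2) (auto simp: indicator_def)
      show "(\<lambda>t. ?k t * u t) \<in> borel_measurable circle" "(\<lambda>t. ?k t * ?u n t) \<in> borel_measurable circle" for n
        by (intro borel_measurable_times k(1) um \<open>u \<in> borel_measurable circle\<close>)+
    qed simp
    moreover have "(\<lambda>n. LINT s|circle. h s * poisson_integral ?k (of_real (radius n) * cis s)) \<longlonglongrightarrow> (LINT s|circle. h s * ?k s)"
    proof (rule integral_dominated_convergence[where w = "\<lambda>_. B * 1"])
      \<comment> \<open>Off these three points the indicator is locally constant on the circle.\<close>
      have "AE s in circle. s \<notin> {0, a, b}" by (intro negligible_imp_AE_circle) simp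
      moreover have "AE s in circle. s \<in> space circle" by (rule AE_space)
      ultimately show "AE s in circle. (\<lambda>n. h s * poisson_integral ?k (of_real (radius n) * cis s)) \<longlonglongrightarrow> h s * ?k s"
      proof eventually_elim
        case (elim s)
        have "(poisson_integral ?k \<longlongrightarrow> ?k s) (at (cis s) within ball 0 1)"
        proof (rule poisson_integral_tendsto[OF k norm_cis])
          fix e :: real assume "e > 0"
          have "min \<bar>s - a\<bar> \<bar>s - b\<bar> > 0" using elim by auto
          moreover have "0 < s" "s < 2 * pi" using elim by auto
          ultimately obtain d where d: "d > 0"
            "\<And>t. t \<in> space circle \<Longrightarrow> norm (cis t - cis s) < d \<Longrightarrow> \<bar>t - s\<bar> < min \<bar>s - a\<bar> \<bar>s - b\<bar>"
            using cis_near_imp_near[of s "min \<bar>s - a\<bar> \<bar>s - b\<bar>"] by blast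
          have "?k t = ?k s" if "t \<in> space circle" "norm (cis t - cis s) < d" for t
            using d(2)[OF that] by (auto simp: indicator_def)
          then show "\<exists>d>0. \<forall>t\<in>space circle. norm (cis t - cis s) < d \<longrightarrow> \<bar>?k t - ?k s\<bar> \<le> e"
            using d(1) \<open>e > 0\<close> by (intro exI[of _ d]) (auto simp del: space_circle)
        qed
        from filterlim_compose[OF this radial_approach_ball] show ?case by (intro tendsto_intros)
      qed
      show "AE s in circle. norm (h s * poisson_integral ?k (of_real (radius n) * cis s)) \<le> B * 1" for n
        unfolding real_norm_def abs_mult using h(2) poisson_integral_abs_le[OF nr k(1), of 1] k(2) B0
        by (intro AE_I2 mult_mono) auto
      have "continuous_on (ball 0 1) (poisson_integral ?k)"
        using continuous_on_Re[OF holomorphic_on_imp_continuous_on[OF normalized_harmonic_conjugate_poisson[OF k(1), of 1]]] k(2) by simp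
      then have "(\<lambda>s. poisson_integral ?k (of_real (radius n) * cis s)) \<in> borel_measurable circle" for n
        by (intro measurable_circle_continuous continuous_on_radial)
      then show "(\<lambda>s. h s * poisson_integral ?k (of_real (radius n) * cis s)) \<in> borel_measurable circle" for n
        by (intro borel_measurable_times h(1))
      show "(\<lambda>s. h s * ?k s) \<in> borel_measurable circle"
        by (intro borel_measurable_times h(1) k(1))
    qed simp
    moreover have "(LINT t|circle. ?k t * ?u n t) = (LINT s|circle. h s * poisson_integral ?k (of_real (radius n) * cis s))" for n
      using radius_bounds[of n] by (intro circle_LINT_poisson_duality[OF h k]) auto
    ultimately show ?thesis by (simp add: LIMSEQ_unique mult.commute)
  qed
  \<comment> \<open>The differentiation theorem is stated on the line, hence the extension by zero.\<close>
  define w where "w t = (if t \<in> {0..<2*pi} then u t - h t else 0)" for t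
  have int: "integrable circle (\<lambda>t. u t - h t)" "integrable circle u" "integrable circle h"
    using integrable_circle_bounded[of u B] integrable_circle_bounded[of h B] uB h(2) by auto
  then have wint: "integrable lebesgue w"
    unfolding circle_def w_def by (subst Lebesgue_Measure.integrable_restrict_UNIV) auto
  have wint': "integrable (lebesgue_on {a..b}) w" for a b
    using integrable_mult_indicator[OF _ wint, of "{a..b}"] by (subst integrable_restrict_space) auto
  have w0: "integral {a..b} w = 0" for a b
  proof -
    let ?k = "indicator {a..b} :: real \<Rightarrow> real"
    have km: "?k \<in> borel_measurable circle"
      unfolding circle_def by (intro measurable_restrict_space1 borel_measurable_indicator) simp
    have "integral {a..b} w = (LINT t|lebesgue_on {a..b}. w t)"
      by (rule lebesgue_integral_eq_integral[OF wint', symmetric]) simp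
    also have "\<dots> = (LINT t|lebesgue. (if t \<in> {a..b} then w t else 0))"
      by (rule Lebesgue_Measure.integral_restrict_UNIV[symmetric]) simp
    also have "\<dots> = (LINT t|lebesgue. (if t \<in> {0..<2*pi} then ?k t * u t - ?k t * h t else 0))"
      by (intro Bochner_Integration.integral_cong) (auto simp: w_def)
    also have "\<dots> = (LINT t|circle. ?k t * u t - ?k t * h t)"
      unfolding circle_def by (rule Lebesgue_Measure.integral_restrict_UNIV) simp
    also have "\<dots> = (LINT t|circle. ?k t * u t) - (LINT t|circle. ?k t * h t)"
    proof (intro Bochner_Integration.integral_diff)
      show "integrable circle (\<lambda>t. ?k t * u t)"
        using uB by (intro integrable_circle_bounded[where B = B] borel_measurable_times km \<open>u \<in> borel_measurable circle\<close>)
          (auto elim!: eventually_mono simp: indicator_def B0)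
      show "integrable circle (\<lambda>t. ?k t * h t)"
        using AEh by (intro integrable_circle_bounded[where B = B] borel_measurable_times km h(1))
          (auto elim!: eventually_mono simp: indicator_def B0)
    qed
    also have "\<dots> = 0" using weak[of a b] by simp
    finally show ?thesis .
  qed
  have "w integrable_on cbox a b" for a b
    unfolding box_real by (rule integrable_on_lebesgue_on[OF wint']) simp
  from integrable_ccontinuous_explicit[of w, OF this] obtain N where N: "negligible N"
    "\<And>x e. \<lbrakk>x \<notin> N; 0 < e\<rbrakk> \<Longrightarrow> \<exists>d>0. \<forall>h. 0 < h \<and> h < d \<longrightarrow>
       norm (integral (cbox x (x + h *\<^sub>R One)) w /\<^sub>R h ^ DIM(real) - w x) < e"
    by blast
  have Nw: "norm (w x) < e" if x: "x \<notin> N" "0 < e" for x e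
  proof -
    obtain d where d: "d > 0" "\<forall>h. 0 < h \<and> h < d \<longrightarrow>
       norm (integral (cbox x (x + h *\<^sub>R One)) w /\<^sub>R h ^ DIM(real) - w x) < e"
      using N(2)[OF x] by blast
    then show ?thesis using d(2)[rule_format, of "d / 2"] by (simp add: w0)
  qed
  have "AE t in circle. t \<notin> N" by (rule negligible_imp_AE_circle[OF N(1)])
  moreover have "AE t in circle. t \<in> space circle" by (rule AE_space)
  ultimately show ?thesis using lim
  proof eventually_elim
    case (elim t)
    have "w t = 0" using Nw[OF elim(1)] by (metis less_irrefl zero_less_norm_iff)
    then have "u t = h t" using elim(2) by (simp add: w_def)
    then show ?case using elim(3) by simp
  qed
qed

text \<open>Truncating \<open>h\<close> at its essential bound changes neither the Poisson integral nor the almost everywhere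
  class.\<close>

lemma poisson_integral_radial_limit:
  assumes h: "h \<in> borel_measurable circle" "AE t in circle. \<bar>h t\<bar> \<le> B"
  shows "AE t in circle. (\<lambda>n. poisson_integral h (of_real (radius n) * cis t)) \<longlonglongrightarrow> h t"
proof -
  define k where "k t = max (- \<bar>B\<bar>) (min \<bar>B\<bar> (h t))" for t
  have km: "k \<in> borel_measurable circle" unfolding k_def using h(1) by measurable
  have eq: "AE t in circle. h t = k t" using h(2) by eventually_elim (auto simp: k_def)
  have "AE t in circle. (\<lambda>n. poisson_integral k (of_real (radius n) * cis t)) \<longlonglongrightarrow> k t"
    by (rule poisson_integral_radial_limit_of_bounded[OF km, where B = "\<bar>B\<bar>"]) (auto simp: k_def)
  then show ?thesis using eq
  proof eventually_elim
    case (elim t)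
    have "poisson_integral h (of_real (radius n) * cis t) = poisson_integral k (of_real (radius n) * cis t)" for n
      using radius_bounds[of n] by (intro poisson_integral_cong_AE[OF h(1) km eq]) (simp only: norm_radius_mult norm_cis mult_1_right)
    then show ?case using elim by simp
  qed
qed

section \<open>A subharmonic barrier and the lower bound\<close>

text \<open>With this rate \<open>\<beta>\<close> one has \<open>\<bar>\<beta> u\<bar> \<le> \<pi> / 3\<close>, hence \<open>cos (\<beta> u) \<ge> 1 / 2\<close>, on the strip \<open>\<bar>u\<bar> \<le> M\<close>.\<close>

definition decay_rate :: "real \<Rightarrow> real" where "decay_rate M = pi / (3 * M)"

text \<open>The height at which \<open>exp (- \<beta> v) = 1 / 4\<close>.  From here on the bracket in \<open>far_barrier\<close> is at least \<open>1 / 2\<close>,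
  which makes the bounded harmonic piece take over from the exponentially growing one.\<close>

definition crossover :: "real \<Rightarrow> real" where "crossover M = ln 4 / decay_rate M"

text \<open>The real part of a holomorphic function of \<open>u + i v\<close>; on the strip \<open>\<bar>u\<bar> \<le> M\<close> it is bounded above, and it is
  nonpositive for \<open>v \<le> 0\<close>.\<close>

definition far_barrier :: "real \<Rightarrow> real \<Rightarrow> real \<Rightarrow> real" where
  "far_barrier M u v = 2 * exp (crossover M) * (1 - 2 * exp (- (decay_rate M * v)) * cos (decay_rate M * u))"

text \<open>Below the crossover height this is \<open>cos u * exp v = Re exp (- i (u + i v))\<close>, cut off to zero for
  \<open>\<bar>u\<bar> \<ge> \<pi> / 2\<close>.  Above that height it is only required to be continuous and to stay below the far barrier.\<close>

definition near_barrier :: "real \<Rightarrow> real \<Rightarrow> real \<Rightarrow> real" where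
  "near_barrier M u v = cos (max (- (pi / 2)) (min (pi / 2) u)) * exp (min v (crossover M))"

definition barrier :: "real \<Rightarrow> real \<Rightarrow> real \<Rightarrow> real" where
  "barrier M u v = max (far_barrier M u v) (near_barrier M u v)"

lemma near_barrier_nonneg: "0 \<le> near_barrier M u v"
  unfolding near_barrier_def by (intro mult_nonneg_nonneg cos_ge_zero) (auto simp: max_def min_def)

lemma near_barrier_le: "near_barrier M u v \<le> exp (crossover M)"
proof -
  have "near_barrier M u v \<le> 1 * exp (crossover M)"
    unfolding near_barrier_def by (intro mult_mono) auto
  then show ?thesis by simp
qed

lemma near_barrier_eq_0: "\<bar>u\<bar> \<ge> pi / 2 \<Longrightarrow> near_barrier M u v = 0"
proof -
  assume "\<bar>u\<bar> \<ge> pi / 2"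
  then consider "u \<ge> pi / 2" | "u \<le> - (pi / 2)" by linarith
  then have "max (- (pi / 2)) (min (pi / 2) u) = pi / 2 \<or> max (- (pi / 2)) (min (pi / 2) u) = - (pi / 2)"
    by cases (use pi_gt_zero in linarith)+
  then have "cos (max (- (pi / 2)) (min (pi / 2) u)) = 0" by (metis cos_minus cos_pi_half)
  then show ?thesis by (simp add: near_barrier_def)
qed

lemma cos_decay_rate:
  assumes "\<bar>u\<bar> \<le> M" "M > 0"
  shows "1 / 2 \<le> cos (decay_rate M * u)"
proof -
  have "\<bar>decay_rate M * u\<bar> \<le> pi / 3"
    using assms by (simp add: decay_rate_def abs_mult divide_simps)
  then have "cos (pi / 3) \<le> cos \<bar>decay_rate M * u\<bar>"
    by (intro cos_monotone_0_pi_le) auto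
  then show ?thesis by (simp add: cos_60)
qed

lemma far_barrier_nonpos:
  assumes "\<bar>u\<bar> \<le> M" "M > 0" "v \<le> 0"
  shows "far_barrier M u v \<le> 0"
proof -
  have "decay_rate M > 0" using assms(2) by (simp add: decay_rate_def)
  then have "1 \<le> exp (- (decay_rate M * v))" using assms(3) by (simp add: mult_nonneg_nonpos)
  then have "1 * (1 / 2) \<le> exp (- (decay_rate M * v)) * cos (decay_rate M * u)"
    using cos_decay_rate[OF assms(1,2)] by (intro mult_mono) auto
  then show ?thesis unfolding far_barrier_def by (intro mult_nonneg_nonpos) auto
qed

lemma far_barrier_le:
  assumes "\<bar>u\<bar> \<le> M" "M > 0"
  shows "far_barrier M u v \<le> 2 * exp (crossover M)"
proof -
  have "0 \<le> exp (- (decay_rate M * v)) * cos (decay_rate M * u)"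
    using cos_decay_rate[OF assms] by simp
  then have "1 - 2 * exp (- (decay_rate M * v)) * cos (decay_rate M * u) \<le> 1" by linarith
  then show ?thesis unfolding far_barrier_def by (intro mult_left_le) auto
qed

lemma near_le_far_barrier:
  assumes "\<bar>u\<bar> \<le> M" "M > 0" "crossover M \<le> v"
  shows "near_barrier M u v \<le> far_barrier M u v"
proof -
  have d: "decay_rate M > 0" using assms(2) by (simp add: decay_rate_def)
  then have "ln 4 \<le> decay_rate M * v"
    using assms(3) by (simp add: crossover_def divide_le_eq mult.commute)
  then have "exp (- (decay_rate M * v)) \<le> exp (- ln 4)" by simp
  also have "\<dots> = 1 / 4" by (simp add: exp_minus inverse_eq_divide)
  finally have "exp (- (decay_rate M * v)) * cos (decay_rate M * u) \<le> 1 / 4 * 1"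
    by (intro mult_mono) (use cos_decay_rate[OF assms(1,2)] in auto)
  then have "2 * exp (crossover M) * (1 / 2) \<le> far_barrier M u v"
    unfolding far_barrier_def by (intro mult_left_mono) auto
  then show ?thesis using near_barrier_le[of M u v] by simp
qed

lemma barrier_nonneg: "0 \<le> barrier M u v"
  using near_barrier_nonneg[of M u v] by (simp add: barrier_def le_max_iff_disj)

lemma barrier_le:
  assumes "\<bar>u\<bar> \<le> M" "M > 0"
  shows "barrier M u v \<le> 2 * exp (crossover M)"
  using far_barrier_le[OF assms, of v] near_barrier_le[of M u v] exp_gt_zero[of "crossover M"]
  unfolding barrier_def by (intro max.boundedI) linarith+

text \<open>This is why the level set appears: boundary values with \<open>\<bar>h\<bar> \<ge> \<pi> / 2\<close> contribute only where the
  conjugate function exceeds the level.\<close>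

lemma barrier_eq_0:
  assumes "\<bar>u\<bar> \<le> M" "M > 0" "pi / 2 \<le> \<bar>u\<bar>" "v \<le> 0"
  shows "barrier M u v = 0"
  using far_barrier_nonpos[OF assms(1,2,4)] near_barrier_eq_0[OF assms(3)] by (simp add: barrier_def)

lemma barrier_zero_ge: "exp (min v (crossover M)) \<le> barrier M 0 v"
proof -
  have "max (- (pi / 2)) (min (pi / 2) 0) = 0" using pi_gt_zero by linarith
  then have "near_barrier M 0 v = exp (min v (crossover M))" by (simp only: near_barrier_def cos_zero mult_1)
  then show ?thesis by (simp add: barrier_def)
qed

lemma continuous_on_barrier:
  fixes f g :: "'a :: t2_space \<Rightarrow> real"
  assumes "continuous_on A f" "continuous_on A g"
  shows "continuous_on A (\<lambda>x. barrier M (f x) (g x))"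
  unfolding barrier_def far_barrier_def near_barrier_def
  by (intro continuous_intros assms)

text \<open>Where the far barrier attains the maximum, it is a harmonic minorant.  Elsewhere the height is below the crossover, and
  the near barrier is either harmonic near the point or zero, in which case zero is a minorant.\<close>

lemma subharmonic_support_barrier:
  assumes hol: "F holomorphic_on U" and "open U" and "z \<in> U"
    and M: "M > 0" "\<And>w. w \<in> U \<Longrightarrow> \<bar>Re (F w)\<bar> \<le> M"
  shows "subharmonic_support (\<lambda>w. barrier M (Re (F w)) (Im (F w))) z"
proof -
  let ?S = "\<lambda>w. barrier M (Re (F w)) (Im (F w))"
  let ?d = "complex_of_real (decay_rate M)"
  have contF: "continuous_on U F" by (rule holomorphic_on_imp_continuous_on[OF hol])
  show ?thesis
  proof (cases "near_barrier M (Re (F z)) (Im (F z)) \<le> far_barrier M (Re (F z)) (Im (F z))")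
    case True
    define q where "q w = of_real (2 * exp (crossover M)) * (1 - 2 * exp (\<i> * (?d * F w)))" for w
    have q: "Re (q w) = far_barrier M (Re (F w)) (Im (F w))" for w
      by (simp add: q_def far_barrier_def Re_exp)
    have "q holomorphic_on U" unfolding q_def by (intro holomorphic_intros hol)
    moreover have "Re (q z) = ?S z" using True by (simp add: q barrier_def)
    moreover have "Re (q w) \<le> ?S w" for w by (simp add: q barrier_def)
    ultimately show ?thesis unfolding subharmonic_support_def using assms(2,3) by blast
  next
    case False
    then have v: "Im (F z) < crossover M"
      using near_le_far_barrier[OF M(2)[OF \<open>z \<in> U\<close>] M(1), of "Im (F z)"] by linarith
    show ?thesis
    proof (cases "\<bar>Re (F z)\<bar> < pi / 2")
      case True
      define V where "V = {w \<in> U. \<bar>Re (F w)\<bar> < pi / 2 \<and> Im (F w) < crossover M}"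
      have V_eq: "V = U \<inter> F -` {w. \<bar>Re w\<bar> < pi / 2 \<and> Im w < crossover M}" by (auto simp: V_def)
      have "open {w. \<bar>Re w\<bar> < pi / 2 \<and> Im w < crossover M}"
        by (intro open_Collect_conj open_Collect_less continuous_intros)
      then have "open V" unfolding V_eq by (rule continuous_open_preimage[OF contF \<open>open U\<close>])
      define q where "q w = exp (- (\<i> * F w))" for w
      have q: "Re (q w) = near_barrier M (Re (F w)) (Im (F w))" if "w \<in> V" for w
      proof -
        have "\<bar>Re (F w)\<bar> < pi / 2" "Im (F w) < crossover M" using that by (auto simp: V_def)
        then have "max (- (pi / 2)) (min (pi / 2) (Re (F w))) = Re (F w)" "min (Im (F w)) (crossover M) = Im (F w)"
          by linarith+
        then show ?thesis by (simp add: q_def near_barrier_def Re_exp)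
      qed
      have "q holomorphic_on V" unfolding q_def
        by (intro holomorphic_intros holomorphic_on_subset[OF hol]) (auto simp: V_def)
      moreover have "z \<in> V" using True v \<open>z \<in> U\<close> by (simp add: V_def)
      moreover have "Re (q z) = ?S z" using False q[OF \<open>z \<in> V\<close>] by (simp add: barrier_def)
      moreover have "Re (q w) \<le> ?S w" if "w \<in> V" for w using q[OF that] by (simp add: barrier_def)
      ultimately show ?thesis unfolding subharmonic_support_def using \<open>open V\<close> by blast
    next
      case False2: False
      then have "near_barrier M (Re (F z)) (Im (F z)) = 0" by (intro near_barrier_eq_0) simp
      then have "?S z = 0" using False by (simp add: barrier_def)
      then show ?thesis unfolding subharmonic_support_def using assms(2,3) barrier_nonneg
        by (intro exI[of _ U] exI[of _ "\<lambda>_. 0"]) auto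
    qed
  qed
qed

lemma LINT_circle_indicator:
  "A \<in> sets circle \<Longrightarrow> (LINT t|circle. c * indicator A t) = c * measure circle A"
  by (simp add: Int_absorb2[OF sets.sets_into_space] del: space_circle)

text \<open>With \<open>S = B(u, v - s)\<close>, the value of \<open>S\<close> at \<open>z0\<close> is at most the Poisson integral at \<open>z0\<close> of its boundary values.
  These are bounded by \<open>K\<close> and, up to a null set, supported where the conjugate function exceeds \<open>s\<close>.  The
  dilates of \<open>S\<close> make the comparison legitimate, as \<open>S\<close> itself need not be continuous up to the circle.\<close>

lemma conjugate_function_distribution_lower_bound:
  assumes h: "h \<in> borel_measurable circle" "AE t in circle. \<bar>h t\<bar> \<le> M" and "M > 0"
    and big: "AE t in circle. pi / 2 \<le> \<bar>h t\<bar>"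
    and z0: "z0 \<in> ball 0 1" "poisson_integral h z0 = 0"
  shows "\<exists>C>0. \<forall>s\<ge>0. measure circle {t \<in> space circle. conjugate_function h t > s} \<ge> C * exp (- s)"
proof -
  define u where "u = poisson_integral h"
  define v where "v = normalized_harmonic_conjugate u"
  define F where "F z = Complex (u z) (v z)" for z
  have hol: "F holomorphic_on ball 0 1"
    unfolding F_def u_def v_def by (rule normalized_harmonic_conjugate_poisson[OF h])
  have uM: "\<bar>u z\<bar> \<le> M" if "z \<in> ball 0 1" for z
    using poisson_integral_abs_le[OF _ h, of z] that by (simp add: u_def)
  have contu: "continuous_on (ball 0 1) u" and contv: "continuous_on (ball 0 1) v"
    using continuous_on_Re[OF holomorphic_on_imp_continuous_on[OF hol]]
      continuous_on_Im[OF holomorphic_on_imp_continuous_on[OF hol]] by (simp_all add: F_def)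
  define K where "K = 2 * exp (crossover M)"
  define A where "A = (1 + norm z0) / (1 - norm z0)"
  have nz0: "norm z0 < 1" using z0(1) by simp
  have A: "A > 0" using nz0 by (simp add: A_def add_pos_nonneg)
  have K: "K > 0" by (simp add: K_def)
  define c where "c = exp (min (v z0) (crossover M))"
  note rb = radius_mult_in_ball
  have meas: "conjugate_function h \<in> borel_measurable circle" by (rule measurable_conjugate_function[OF h])
  have main: "2 * pi * c * exp (- s) \<le> A * K * measure circle {t \<in> space circle. conjugate_function h t > s}"
    if "s \<ge> 0" for s
  proof -
    define S where "S z = barrier M (u z) (v z - s)" for z
    define Sb where "Sb t = barrier M (h t) (conjugate_function h t - s)" for t
    let ?L = "{t \<in> space circle. conjugate_function h t > s}"
    have contS: "continuous_on (ball 0 1) S"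
      unfolding S_def by (intro continuous_on_barrier continuous_intros contu contv)
    have S_bounds: "0 \<le> S z" "z \<in> ball 0 1 \<Longrightarrow> S z \<le> K" for z
      using barrier_nonneg barrier_le[OF uM \<open>M > 0\<close>] by (auto simp: S_def K_def)
    have suppS: "subharmonic_support (\<lambda>w. S (of_real (radius n) * w)) z" if "z \<in> ball 0 1" for n z
    proof -
      have "(\<lambda>w. F (of_real (radius n) * w) - \<i> * of_real s) holomorphic_on ball 0 1"
        by (intro holomorphic_intros holomorphic_on_compose_gen[OF _ hol, unfolded o_def])
           (use rb in auto)
      from subharmonic_support_barrier[OF this open_ball that \<open>M > 0\<close>]
      show ?thesis using uM rb by (simp add: F_def S_def)
    qed
    have contSn: "continuous_on (cball 0 1) (\<lambda>w. S (of_real (radius n) * w))" for n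
      by (rule continuous_on_compose2[OF contS]) (use rb in \<open>auto intro!: continuous_intros\<close>)
    have le: "S (of_real (radius n) * z0)
        \<le> 1 / (2 * pi) * (LINT t|circle. poisson_kernel z0 t * S (of_real (radius n) * cis t))" for n
      using subharmonic_le_poisson_integral[OF contSn suppS z0(1)] unfolding poisson_integral_kernel .
    have "(\<lambda>n. of_real (radius n) * z0) \<longlonglongrightarrow> of_real 1 * z0"
      by (intro tendsto_intros radius_tendsto)
    then have "(\<lambda>n. S (of_real (radius n) * z0)) \<longlonglongrightarrow> S z0"
      using contS z0(1) by (intro isCont_tendsto_compose[of _ S]) (auto simp: continuous_on_eq_continuous_at)
    moreover have "(\<lambda>n. LINT t|circle. poisson_kernel z0 t * S (of_real (radius n) * cis t))
        \<longlonglongrightarrow> (LINT t|circle. poisson_kernel z0 t * Sb t)"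
    proof (rule integral_dominated_convergence[where w = "\<lambda>_. A * K"])
      have contB: "continuous_on UNIV (\<lambda>p. barrier M (fst p) (snd p - s))"
        by (intro continuous_on_barrier continuous_intros)
      have "(\<lambda>t. barrier M (fst (h t, conjugate_function h t)) (snd (h t, conjugate_function h t) - s)) \<in> borel_measurable circle"
        by (rule borel_measurable_continuous_on[OF contB borel_measurable_Pair[OF h(1) meas]])
      then show "(\<lambda>t. poisson_kernel z0 t * Sb t) \<in> borel_measurable circle"
        unfolding Sb_def by (intro borel_measurable_times measurable_poisson_kernel nz0) simp
      show "(\<lambda>t. poisson_kernel z0 t * S (of_real (radius n) * cis t)) \<in> borel_measurable circle" for n
        by (intro borel_measurable_times measurable_poisson_kernel nz0 measurable_circle_continuous continuous_on_radial contS)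
      show "AE t in circle. norm (poisson_kernel z0 t * S (of_real (radius n) * cis t)) \<le> A * K" for n
        unfolding real_norm_def abs_mult A_def
        using poisson_kernel_le[OF nz0] poisson_kernel_nonneg[OF nz0] S_bounds rb[OF eq_refl[OF norm_cis]] A
        by (intro AE_I2 mult_mono) (auto simp: A_def)
      show "AE t in circle. (\<lambda>n. poisson_kernel z0 t * S (of_real (radius n) * cis t)) \<longlonglongrightarrow> poisson_kernel z0 t * Sb t"
        using poisson_integral_radial_limit[OF h] conjugate_function_radial_limit(1)[OF h]
      proof eventually_elim
        case (elim t)
        have "(\<lambda>n. (u (of_real (radius n) * cis t), v (of_real (radius n) * cis t))) \<longlonglongrightarrow> (h t, conjugate_function h t)"
          using elim unfolding u_def v_def by (intro tendsto_Pair)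
        from isCont_tendsto_compose[OF _ this, of "\<lambda>p. barrier M (fst p) (snd p - s)"] contB
        have "(\<lambda>n. S (of_real (radius n) * cis t)) \<longlonglongrightarrow> Sb t"
          by (simp add: S_def Sb_def continuous_on_eq_continuous_at)
        then show ?case by (intro tendsto_intros)
      qed
    qed simp
    then have "(\<lambda>n. 1 / (2 * pi) * (LINT t|circle. poisson_kernel z0 t * S (of_real (radius n) * cis t)))
        \<longlonglongrightarrow> 1 / (2 * pi) * (LINT t|circle. poisson_kernel z0 t * Sb t)"
      by (rule tendsto_mult_left)
    ultimately have "S z0 \<le> 1 / (2 * pi) * (LINT t|circle. poisson_kernel z0 t * Sb t)"
      using le by (intro LIMSEQ_le) auto
    then have upper: "2 * pi * S z0 \<le> (LINT t|circle. poisson_kernel z0 t * Sb t)" by (simp add: field_simps)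
    have L: "?L \<in> sets circle" by (rule borel_measurable_less[OF borel_measurable_const meas])
    note upper
    also have "(LINT t|circle. poisson_kernel z0 t * Sb t) \<le> (LINT t|circle. A * K * indicator ?L t)"
    proof (rule integral_mono_AE')
      show "integrable circle (\<lambda>t. A * K * indicator ?L t)"
        using L by (intro integrable_mult_right integrable_real_indicator) (auto simp: circle.emeasure_finite less_top[symmetric])
      show "AE t in circle. 0 \<le> A * K * indicator ?L t" using A K by simp
      have "AE t in circle. t \<in> space circle" by (rule AE_space)
      then show "AE t in circle. poisson_kernel z0 t * Sb t \<le> A * K * indicator ?L t"
        using h(2) big
      proof eventually_elim
        case (elim t)
        show ?case
        proof (cases "conjugate_function h t > s")
          case True
          have "poisson_kernel z0 t * Sb t \<le> A * K"
            using poisson_kernel_le[OF nz0, of t] poisson_kernel_nonneg[OF nz0, of t] A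
              barrier_le[OF elim(2) \<open>M > 0\<close>] barrier_nonneg
            by (intro mult_mono) (auto simp: A_def Sb_def K_def)
          then show ?thesis using True elim(1) by simp
        next
          case False
          then have "Sb t = 0" unfolding Sb_def using elim \<open>M > 0\<close> by (intro barrier_eq_0) auto
          then show ?thesis using A K by simp
        qed
      qed
    qed
    also have "\<dots> = A * K * measure circle ?L" by (rule LINT_circle_indicator[OF L])
    finally have "2 * pi * S z0 \<le> A * K * measure circle ?L" .
    moreover have "c * exp (- s) \<le> S z0"
    proof -
      \<comment> \<open>The minimum in \<open>c\<close> makes the bound hold at every level \<open>s \<ge> 0\<close>, also where \<open>v z0 - s\<close> is above the crossover.\<close>
      have "c * exp (- s) = exp (min (v z0) (crossover M) - s)" by (simp add: c_def exp_diff exp_minus divide_inverse)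
      also have "\<dots> \<le> exp (min (v z0 - s) (crossover M))" using that by simp
      also have "\<dots> \<le> S z0" unfolding S_def using barrier_zero_ge z0(2) by (simp add: u_def)
      finally show ?thesis .
    qed
    then have "2 * pi * (c * exp (- s)) \<le> 2 * pi * S z0" by (intro mult_left_mono) auto
    ultimately show ?thesis by linarith
  qed
  show ?thesis
  proof (intro exI[of _ "2 * pi * c / (A * K)"] conjI allI impI)
    show "0 < 2 * pi * c / (A * K)" using A K by (simp add: c_def)
    show "2 * pi * c / (A * K) * exp (- s) \<le> measure circle {t \<in> space circle. conjugate_function h t > s}" if "s \<ge> 0" for s
      using main[OF that] A K by (simp add: field_simps)
  qed
qed

text \<open>If \<open>exp X\<close> were integrable, then \<open>exp n\<close> times the measure of the set where \<open>X > n\<close> would tend to \<open>0\<close>,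
  being at most the integral of \<open>exp X\<close> over this set.\<close>

lemma not_integrable_exp_of_distribution:
  assumes X: "X \<in> borel_measurable circle" and "C > 0"
    and dist: "\<And>s. s \<ge> 0 \<Longrightarrow> C * exp (- s) \<le> measure circle {t \<in> space circle. X t > s}"
  shows "\<not> integrable circle (\<lambda>t. exp (X t))"
proof
  assume int: "integrable circle (\<lambda>t. exp (X t))"
  let ?L = "\<lambda>n :: nat. {t \<in> space circle. X t > real n}"
  have L: "?L n \<in> sets circle" for n by (rule borel_measurable_less[OF borel_measurable_const X])
  have Lint: "integrable circle (indicator (?L n) :: real \<Rightarrow> real)" for n
    using L by (intro integrable_real_indicator) (auto simp: circle.emeasure_finite less_top[symmetric])
  have "(\<lambda>n. LINT t|circle. indicator (?L n) t * exp (X t)) \<longlonglongrightarrow> (LINT t|circle. 0)"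
  proof (rule integral_dominated_convergence[OF _ _ int])
    show "AE t in circle. (\<lambda>n. indicator (?L n) t * exp (X t)) \<longlonglongrightarrow> 0"
    proof (intro AE_I2 tendsto_eventually)
      fix t
      obtain m :: nat where "X t \<le> real m" using real_arch_simple by blast
      then show "\<forall>\<^sub>F n in sequentially. indicator (?L n) t * exp (X t) = 0"
        by (auto simp: eventually_sequentially indicator_def intro!: exI[of _ m])
    qed
    show "(\<lambda>t. indicator (?L n) t * exp (X t)) \<in> borel_measurable circle" for n
      using L X by measurable
  qed (auto simp: indicator_def)
  moreover have "C \<le> (LINT t|circle. indicator (?L n) t * exp (X t))" for n
  proof -
    have "C = exp (real n) * (C * exp (- real n))" by (simp add: exp_minus)
    also have "\<dots> \<le> exp (real n) * measure circle (?L n)" by (intro mult_left_mono dist) auto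
    also have "\<dots> = (LINT t|circle. exp (real n) * indicator (?L n) t)"
      by (rule LINT_circle_indicator[OF L, symmetric])
    also have "\<dots> \<le> (LINT t|circle. indicator (?L n) t * exp (X t))"
    proof (rule integral_mono)
      show "integrable circle (\<lambda>t. exp (real n) * indicator (?L n) t)" by (intro integrable_mult_right Lint)
      show "integrable circle (\<lambda>t. indicator (?L n) t * exp (X t))"
        using integrable_mult_indicator[OF L int] by (simp only: real_scaleR_def)
      show "exp (real n) * indicator (?L n) t \<le> indicator (?L n) t * exp (X t)" for t
        by (auto simp: indicator_def)
    qed
    finally show ?thesis .
  qed
  ultimately have "C \<le> 0" by (intro LIMSEQ_le_const[of _ 0]) auto
  then show False using \<open>C > 0\<close> by simp
qed

lemma AE_circle_witness:
  assumes "A \<in> sets circle" "0 < measure circle A" "AE t in circle. P t"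
  shows "\<exists>t\<in>A. P t"
proof (rule ccontr)
  assume "\<not> ?thesis"
  then have "AE t in circle. t \<notin> A" using assms(3) by (auto elim: eventually_mono)
  then have "A \<in> null_sets circle" using assms(1) by (simp add: AE_iff_null_sets)
  then show False using assms(2) by (simp add: measure_eq_0_null_sets)
qed

theorem theorem1:
  fixes f :: "real \<Rightarrow> real" and E :: "real set"
  assumes "f \<in> L_infinity"
    and "AE t in circle. f t \<ge> pi / 2"
    and "E \<in> sets circle"
    and "0 < measure circle E" and "measure circle E < 2 * pi"
  shows "(\<exists>C>0. \<forall>s\<ge>0.
            measure circle {t \<in> space circle. conjugate_function (\<lambda>x. f x * rho E x) t > s}
              \<ge> C * exp (- s))
       \<and> \<not> integrable circle (\<lambda>t. exp (conjugate_function (\<lambda>x. f x * rho E x) t))"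
proof -
  define h where "h = (\<lambda>x. f x * rho E x)"
  obtain M0 where f: "f \<in> borel_measurable circle" "AE t in circle. \<bar>f t\<bar> \<le> M0"
    using assms(1) by (auto simp: L_infinity_def)
  define M where "M = max M0 1"
  have "M > 0" by (simp add: M_def)
  have hm: "h \<in> borel_measurable circle"
    unfolding h_def rho_def using f(1) assms(3) by measurable
  have abs: "\<bar>h t\<bar> = \<bar>f t\<bar>" for t by (auto simp: h_def rho_def indicator_def)
  have hM: "AE t in circle. \<bar>h t\<bar> \<le> M" using f(2) by eventually_elim (auto simp: abs M_def)
  have big: "AE t in circle. pi / 2 \<le> \<bar>h t\<bar>" using assms(2) by eventually_elim (auto simp: abs)
  let ?u = "poisson_integral h"
  have lim: "AE t in circle. (\<lambda>n. ?u (of_real (radius n) * cis t)) \<longlonglongrightarrow> h t \<and> pi / 2 \<le> f t"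
    using poisson_integral_radial_limit[OF hm hM] assms(2) by eventually_elim auto
  note rb = radius_mult_in_ball[OF eq_refl[OF norm_cis]]
  \<comment> \<open>Radial limits on \<open>E\<close> and on its complement show that \<open>u\<close> takes both signs; hence it vanishes somewhere.\<close>
  have "\<exists>z1\<in>ball 0 1. 0 < ?u z1"
  proof -
    obtain t where t: "t \<in> E" "(\<lambda>n. ?u (of_real (radius n) * cis t)) \<longlonglongrightarrow> h t" "pi / 2 \<le> f t"
      using AE_circle_witness[OF assms(3,4) lim] by blast
    have "0 < f t" using t(3) pi_gt_zero by linarith
    then have "0 < h t" using t(1) by (simp add: h_def rho_def)
    then have "\<forall>\<^sub>F n in sequentially. 0 < ?u (of_real (radius n) * cis t)"
      by (rule order_tendstoD(1)[OF t(2)])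
    then show ?thesis using rb by (auto simp: eventually_sequentially)
  qed
  then obtain z1 where z1: "z1 \<in> ball 0 1" "0 < ?u z1" by blast
  have "\<exists>z2\<in>ball 0 1. ?u z2 < 0"
  proof -
    have "space circle - E \<in> sets circle" using assms(3) by blast
    moreover have "0 < measure circle (space circle - E)"
      using circle.finite_measure_compl[OF assms(3)] assms(5) measure_space_circle by linarith
    ultimately obtain t where t: "t \<notin> E" "(\<lambda>n. ?u (of_real (radius n) * cis t)) \<longlonglongrightarrow> h t" "pi / 2 \<le> f t"
      using AE_circle_witness[OF _ _ lim] by blast
    have "0 < f t" using t(3) pi_gt_zero by linarith
    then have "h t < 0" using t(1) by (simp add: h_def rho_def)
    then have "\<forall>\<^sub>F n in sequentially. ?u (of_real (radius n) * cis t) < 0"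
      by (rule order_tendstoD(2)[OF t(2)])
    then show ?thesis using rb by (auto simp: eventually_sequentially)
  qed
  then obtain z2 where z2: "z2 \<in> ball 0 1" "?u z2 < 0" by blast
  have "continuous_on (ball 0 1) ?u"
    using continuous_on_Re[OF holomorphic_on_imp_continuous_on[OF normalized_harmonic_conjugate_poisson[OF hm hM]]] by simp
  then have "connected (?u ` ball 0 1)" by (intro connected_continuous_image convex_connected convex_ball)
  then have "0 \<in> ?u ` ball 0 1"
    by (rule connectedD_interval[OF _ imageI[OF z2(1)] imageI[OF z1(1)]]) (use z1 z2 in auto)
  then obtain z0 where z0: "z0 \<in> ball 0 1" "?u z0 = 0" by auto
  obtain C where C: "C > 0"
    "\<And>s. s \<ge> 0 \<Longrightarrow> C * exp (- s) \<le> measure circle {t \<in> space circle. conjugate_function h t > s}"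
    using conjugate_function_distribution_lower_bound[OF hm hM \<open>M > 0\<close> big z0] by blast
  have "\<not> integrable circle (\<lambda>t. exp (conjugate_function h t))"
    by (rule not_integrable_exp_of_distribution[OF measurable_conjugate_function[OF hm hM] C])
  moreover have "\<exists>C>0. \<forall>s\<ge>0. C * exp (- s) \<le> measure circle {t \<in> space circle. conjugate_function h t > s}"
    using C by blast
  ultimately show ?thesis unfolding h_def by (rule conjI[rotated])
qed

end
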